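(* Let $p,q\in\mathbb{N}$ and let $S$ be a VARMA($p,q$) process with instantaneous effects, with full-time marginalized ADMG $\mathcal{G}_S$. Let $A,B,C$ be finite pairwise disjoint sets of nodes of $\mathcal{G}_S$. If $A$ and $C$ are $m$-separated by $B$ in $\mathcal{G}_S$, then $A\perp\!\!\!\perp C\mid B$, i.e. the random variables in $A$ and those in $C$ are conditionally independent given those in $B$.
   Context: VARMA process with instantaneous effects. A $d$-dimensional time series $S=(S_t)_{t\in\mathbb{Z}}$ follows a VARMA($p,q$) process with instantaneous effects if there are matrices $A_0,\ldots,A_p,B_1,\ldots,B_q\in\mathbb{R}^{d\times d}$ with $\mathrm{diag}(A_0)=0$ such that for all $t\in\mathbb{Z}$ $$S_t=A_0S_t+A_1S_{t-1}+\ldots+A_pS_{t-p}+\varepsilon_t+B_1\varepsilon_{t-1}+\ldots+B_q\varepsilon_{t-q},$$ where $\det((I_d-A_0)\lambda^p-A_1\lambda^{p-1}-\ldots-A_p)=0$ implies $|\lambda|<1$, and $(\varepsilon_t)_{t\in\mathbb{Z}}$ is an i.i.d. process with finite second moments and jointly independent components. $S$ is understood to be the stationary solution. Full-time DAG $\mathcal{G}_{full}$. It has nodes $\{S_t^i,\varepsilon_t^i: i\in\{1,\ldots,d\},t\in\mathbb{Z}\}$ and edges: $S_{t-k}^j\to S_t^i$ if $(A_k)_{i,j}\neq0$ ($k\in\{0,\ldots,p\}$); $\varepsilon_{t-l}^j\to S_t^i$ if $(B_l)_{i,j}\neq 0$ ($l\in\{1,\ldots,q\}$); and $\varepsilon_t^i\to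 S_t^i$, for all $t$ and $i$. It is assumed to be acyclic (equivalently, the graph of instantaneous edges given by $A_0$ is acyclic). Full-time marginalized ADMG $\mathcal{G}_S$. An acyclic directed mixed graph (ADMG) is a graph with directed edges $\to$ and bi-directed edges $\leftrightarrow$ without directed cycles; a directed and a bi-directed edge may both join the same two nodes. $\mathcal{G}_S$ is the latent projection of $\mathcal{G}_{full}$ onto the endogenous nodes $\{S_t^i\}$ (computed on a window of $\max(p,q)+2$ consecutive times and then repeated along the time axis). Explicitly: its nodes are $\{S_t^i: t\in\mathbb{Z},i\in\{1,\ldots,d\}\}$; its directed edges are the edges of $\mathcal{G}_{full}$ between endogenous nodes; and for distinct endogenous nodes $v,w$ there is an edge $v\leftrightarrow w$ if and only if some innovation node $\varepsilon_s^j$ has edges $\varepsilon_s^j\to v$ and $\varepsilon_s^j\to w$ in $\mathcal{G}_{full}$. $m$-separation. A path is an alternating sequence of distinct vertices and edges, consecutive vertices being joined by the edge between them. A vertex is a collider in a path if both the preceding and succeeding edges of the path have an arrowhead at it ($\to v\leftarrow$, $\to v\leftrightarrow$, $\leftrightarrow v\leftarrow$, $\leftrightarrow v\leftrightarrow$). $DE(v)$ is the set of nodes reachable from $v$ by directed edges only, including $v$. A path between $v$ and $w$ is blocked by $B\subset V\setminus\{v,w\}$ if some non-collider of the path other than its endpoints is in $B$, or some collider $u$ in it satisfies $DE(u)\cap B=\emptyset$. $A$ and $C$ are $m$-separated by $B$ if every path from a node in $A$ to a node in $C$ is blocked by $B$. *)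

theory Defs
  imports "HOL-Probability.Probability"
begin

section \<open>Mixed graphs and m-separation\<close>

text \<open>Every element of the type \<open>'v\<close> is a vertex. A bi-directed edge is stored in both
  orientations.\<close>

record 'v mixed_graph =
  dir :: "('v \<times> 'v) set"
  bidir :: "('v \<times> 'v) set"

definition admg :: "'v mixed_graph \<Rightarrow> bool" where
  "admg G \<longleftrightarrow> acyclic (dir G) \<and> sym (bidir G) \<and> irrefl (bidir G)"

definition descendants :: "'v mixed_graph \<Rightarrow> 'v \<Rightarrow> 'v set" where
  "descendants G v = {u. (v, u) \<in> (dir G)\<^sup>*}"

text \<open>The three ways of traversing an edge. Since two vertices may be joined by several edges,
  a path records which edge it uses at each step.\<close>

datatype step = Fwd | Bwd | Bidir

fun joins :: "'v mixed_graph \<Rightarrow> 'v \<Rightarrow> step \<Rightarrow> 'v \<Rightarrow> bool" where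
  "joins G v Fwd w \<longleftrightarrow> (v, w) \<in> dir G"
| "joins G v Bwd w \<longleftrightarrow> (w, v) \<in> dir G"
| "joins G v Bidir w \<longleftrightarrow> (v, w) \<in> bidir G"

definition is_path :: "'v mixed_graph \<Rightarrow> 'v list \<Rightarrow> step list \<Rightarrow> bool" where
  "is_path G vs es \<longleftrightarrow> length vs = length es + 1 \<and> distinct vs \<and>
     (\<forall>k<length es. joins G (vs ! k) (es ! k) (vs ! (k + 1)))"

text \<open>The inner vertices of a path are those at the positions \<open>k\<close> with \<open>0 < k < length es\<close>; such a
  vertex lies between the edges \<open>es ! (k - 1)\<close> and \<open>es ! k\<close>.\<close>

definition collider :: "step list \<Rightarrow> nat \<Rightarrow> bool" where
  "collider es k \<longleftrightarrow> es ! (k - 1) \<in> {Fwd, Bidir} \<and> es ! k \<in> {Bwd, Bidir}"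

definition blocked :: "'v mixed_graph \<Rightarrow> 'v set \<Rightarrow> 'v list \<Rightarrow> step list \<Rightarrow> bool" where
  "blocked G Z vs es \<longleftrightarrow>
     (\<exists>k. 0 < k \<and> k < length es \<and> \<not> collider es k \<and> vs ! k \<in> Z) \<or>
     (\<exists>k. 0 < k \<and> k < length es \<and> collider es k \<and> descendants G (vs ! k) \<inter> Z = {})"

text \<open>\<open>X\<close> and \<open>Y\<close> are m-separated by \<open>Z\<close> (the three sets are meant to be disjoint).\<close>

definition m_separated :: "'v mixed_graph \<Rightarrow> 'v set \<Rightarrow> 'v set \<Rightarrow> 'v set \<Rightarrow> bool" where
  "m_separated G X Y Z \<longleftrightarrow>
     (\<forall>vs es. is_path G vs es \<and> hd vs \<in> X \<and> last vs \<in> Y \<longrightarrow> blocked G Z vs es)"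


section \<open>The graphs of a VARMA process with instantaneous effects\<close>

text \<open>A pair \<open>(t, i)\<close> stands for component \<open>i\<close> at time \<open>t\<close>.\<close>

datatype 'd full_node = Endo "int \<times> 'd" | Innov "int \<times> 'd"

definition full_time_edges ::
  "nat \<Rightarrow> nat \<Rightarrow> (nat \<Rightarrow> real^'d^'d) \<Rightarrow> (nat \<Rightarrow> real^'d^'d) \<Rightarrow> ('d full_node \<times> 'd full_node) set" where
  "full_time_edges p q A B =
     {(Endo (t - int k, j), Endo (t, i)) | t k i j. k \<le> p \<and> A k $ i $ j \<noteq> 0} \<union>
     {(Innov (t - int l, j), Endo (t, i)) | t l i j. 1 \<le> l \<and> l \<le> q \<and> B l $ i $ j \<noteq> 0} \<union>
     {(Innov (t, i), Endo (t, i)) | t i. True}"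

text \<open>Latent projection of the full-time graph onto its endogenous nodes. Innovations have no
  parents and only endogenous children, so projecting them out adds no directed edges.\<close>

definition varma_admg ::
  "nat \<Rightarrow> nat \<Rightarrow> (nat \<Rightarrow> real^'d^'d) \<Rightarrow> (nat \<Rightarrow> real^'d^'d) \<Rightarrow> (int \<times> 'd) mixed_graph" where
  "varma_admg p q A B =
     \<lparr>dir = {(v, w). (Endo v, Endo w) \<in> full_time_edges p q A B},
      bidir = {(v, w). v \<noteq> w \<and> (\<exists>u. (Innov u, Endo v) \<in> full_time_edges p q A B \<and>
                                     (Innov u, Endo w) \<in> full_time_edges p q A B)}\<rparr>"

lemma admg_varma_admg:
  assumes "acyclic (full_time_edges p q A B)"
  shows "admg (varma_admg p q A B)"
proof -
  have "(Endo v, Endo w) \<in> (full_time_edges p q A B)\<^sup>+"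
    if "(v, w) \<in> (dir (varma_admg p q A B))\<^sup>+" for v w
    using that
  proof (induction rule: trancl_induct)
    case (base y)
    then show ?case by (auto simp: varma_admg_def)
  next
    case (step y z)
    from step.hyps(2) have "(Endo y, Endo z) \<in> full_time_edges p q A B"
      by (simp add: varma_admg_def)
    with step.IH show ?case by (rule trancl_into_trancl)
  qed
  with assms have "acyclic (dir (varma_admg p q A B))"
    unfolding acyclic_def by blast
  moreover have "sym (bidir (varma_admg p q A B))" "irrefl (bidir (varma_admg p q A B))"
    by (auto simp: varma_admg_def sym_def irrefl_def)
  ultimately show ?thesis by (simp add: admg_def)
qed


section \<open>Processes\<close>

text \<open>Strict stationarity.\<close>

definition stationary ::
  "'w measure \<Rightarrow> (int \<Rightarrow> 'w \<Rightarrow> 'x::topological_space) \<Rightarrow> bool" where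
  "stationary M X \<longleftrightarrow>
     (\<forall>h. distr M (\<Pi>\<^sub>M t\<in>UNIV. borel) (\<lambda>\<omega> t. X (t + h) \<omega>) =
          distr M (\<Pi>\<^sub>M t\<in>UNIV. borel) (\<lambda>\<omega> t. X t \<omega>))"

text \<open>Only \<open>A 0, \<dots>, A p\<close> and \<open>B 1, \<dots>, B q\<close> are used.\<close>

locale varma = prob_space M
  for M :: "'w measure" +
  fixes p q :: nat
    and A B :: "nat \<Rightarrow> real^'d^'d"
    and \<epsilon> S :: "int \<Rightarrow> 'w \<Rightarrow> real^'d"
  assumes diag_A0: "A 0 $ i $ i = 0"
    and stable: "det (\<chi> i j. complex_of_real ((mat 1 - A 0) $ i $ j) * z ^ p
                   - (\<Sum>k=1..p. complex_of_real (A k $ i $ j) * z ^ (p - k))) = 0 \<Longrightarrow> cmod z < 1"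
    and acyclic_full: "acyclic (full_time_edges p q A B)"
    and innov_indep: "indep_vars (\<lambda>_. borel) \<epsilon> UNIV"
    and innov_identical: "distr M borel (\<epsilon> s) = distr M borel (\<epsilon> t)"
    and innov_components: "indep_vars (\<lambda>_. borel) (\<lambda>i \<omega>. \<epsilon> t \<omega> $ i) UNIV"
    and innov_second_moment: "integrable M (\<lambda>\<omega>. (\<epsilon> t \<omega> $ i)\<^sup>2)"
    and S_measurable: "random_variable borel (S t)"
    and S_equation: "AE \<omega> in M. S t \<omega> = (\<Sum>k=0..p. A k *v S (t - int k) \<omega>)
                       + \<epsilon> t \<omega> + (\<Sum>l=1..q. B l *v \<epsilon> (t - int l) \<omega>)"
    and S_stationary: "stationary M S"

text \<open>The random vector of the process values at a set of endogenous nodes.\<close>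

definition values_at ::
  "(int \<Rightarrow> 'w \<Rightarrow> real^'d) \<Rightarrow> (int \<times> 'd) set \<Rightarrow> 'w \<Rightarrow> (int \<times> 'd) \<Rightarrow> real" where
  "values_at S N = (\<lambda>\<omega>. \<lambda>(t, i)\<in>N. S t \<omega> $ i)"


section \<open>Conditional independence\<close>

text \<open>\<open>X\<close> and \<open>Y\<close> are conditionally independent given \<open>Z\<close>:
  \<open>P(X \<in> U, Y \<in> W | Z) = P(X \<in> U | Z) P(Y \<in> W | Z)\<close> almost surely, for all measurable
  \<open>U\<close> and \<open>W\<close>.\<close>

definition (in prob_space) cond_indep_var ::
  "'x measure \<Rightarrow> ('a \<Rightarrow> 'x) \<Rightarrow> 'y measure \<Rightarrow> ('a \<Rightarrow> 'y) \<Rightarrow> 'z measure \<Rightarrow> ('a \<Rightarrow> 'z) \<Rightarrow> bool" where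
  "cond_indep_var Mx X My Y Mz Z \<longleftrightarrow>
     random_variable Mx X \<and> random_variable My Y \<and> random_variable Mz Z \<and>
     (\<forall>U\<in>sets Mx. \<forall>W\<in>sets My. AE \<omega> in M.
        real_cond_exp M (vimage_algebra (space M) Z Mz)
          (indicator (X -` U \<inter> Y -` W \<inter> space M)) \<omega> =
        real_cond_exp M (vimage_algebra (space M) Z Mz) (indicator (X -` U \<inter> space M)) \<omega> *
        real_cond_exp M (vimage_algebra (space M) Z Mz) (indicator (Y -` W \<inter> space M)) \<omega>)"

end

theory Submission
  imports Defs "HOL-Complex_Analysis.Complex_Analysis"
begin

text \<open>Let \<open>W\<close> be the set of ancestors of \<open>NA \<union> NB \<union> NC\<close>. The m-separation splits \<open>W\<close> into two parts
  such that an innovation feeds at most one of them, and such that the parents outside \<open>NB\<close> of a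
  vertex lie in the same part as the vertex; \<open>NA\<close> lies in the first part and \<open>NC\<close> in the second.
  So the structural equation of a vertex involves only vertices of its own part, vertices of \<open>NB\<close>,
  and innovations of its part, and the two families of innovations are independent.

  The past is infinite, so the equations cannot be solved recursively from a starting point. By
  stability the inverse of the autoregressive matrix polynomial is a power series whose coefficients
  tend to zero, and stationarity then shows that every value of the process is almost surely a
  function of the innovations at its ancestors. This handles the times before the first vertex of
  \<open>NB\<close>; at later times finitely many equations remain. Hence the value at \<open>v\<close> is a function of the
  innovations on its side and of the values at the ancestors of \<open>v\<close> in \<open>NB\<close>.

  Independent sigma-algebras stay conditionally independent when the condition is enlarged by a
  variable that depends on one of them and on the previous condition. Adding the vertices of \<open>NB\<close> in
  an ancestral order yields the claim.\<close>

no_notation fps_nth (infixl "$" 75)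

section \<open>m-connecting walks and the partition of the ancestors\<close>

text \<open>The flag records whether the walk enters the vertex through an arrowhead.\<close>

inductive m_reach :: "'v mixed_graph \<Rightarrow> 'v set \<Rightarrow> 'v set \<Rightarrow> 'v \<Rightarrow> bool \<Rightarrow> bool"
  for G X Z where
  start: "x \<in> X \<Longrightarrow> m_reach G X Z x False"
| noncollider: "m_reach G X Z v h \<Longrightarrow> v \<notin> Z \<Longrightarrow> joins G v e w \<Longrightarrow> \<not> (h \<and> e \<in> {Bwd, Bidir}) \<Longrightarrow>
    m_reach G X Z w (e \<in> {Fwd, Bidir})"
| collider: "m_reach G X Z v True \<Longrightarrow> descendants G v \<inter> Z \<noteq> {} \<Longrightarrow> joins G v e w \<Longrightarrow>
    e \<in> {Bwd, Bidir} \<Longrightarrow> m_reach G X Z w (e \<in> {Fwd, Bidir})"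

text \<open>An unblocked path without the distinctness condition: reachability strings edges
  together freely and may revisit vertices. The repetitions are removed afterwards.\<close>

definition m_walk :: "'v mixed_graph \<Rightarrow> 'v set \<Rightarrow> 'v list \<Rightarrow> step list \<Rightarrow> bool" where
  "m_walk G Z vs es \<longleftrightarrow> length vs = length es + 1 \<and>
     (\<forall>k<length es. joins G (vs ! k) (es ! k) (vs ! (k + 1))) \<and>
     (\<forall>k. 0 < k \<longrightarrow> k < length es \<longrightarrow>
        (if collider es k then descendants G (vs ! k) \<inter> Z \<noteq> {} else vs ! k \<notin> Z))"

lemma m_walk_extend:
  assumes w: "m_walk G Z vs es" and j: "joins G (last vs) e w"
    and inner: "es \<noteq> [] \<Longrightarrow> (if last es \<in> {Fwd, Bidir} \<and> e \<in> {Bwd, Bidir}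
                  then descendants G (last vs) \<inter> Z \<noteq> {} else last vs \<notin> Z)"
  shows "m_walk G Z (vs @ [w]) (es @ [e])"
proof -
  have len: "length vs = length es + 1" using w by (simp add: m_walk_def)
  then have vsne: "vs \<noteq> []" by auto
  have lastvs: "last vs = vs ! length es" using len vsne by (simp add: last_conv_nth)
  have joins: "joins G ((vs @ [w]) ! k) ((es @ [e]) ! k) ((vs @ [w]) ! (k + 1))"
    if "k < length (es @ [e])" for k
  proof (cases "k < length es")
    case True
    then show ?thesis using w len by (simp add: m_walk_def nth_append)
  next
    case False
    then have "k = length es" using that by simp
    then show ?thesis using j len lastvs by (simp add: nth_append)
  qed
  have cond: "(if collider (es @ [e]) k then descendants G ((vs @ [w]) ! k) \<inter> Z \<noteq> {}
               else (vs @ [w]) ! k \<notin> Z)" if k: "0 < k" "k < length (es @ [e])" for k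
  proof (cases "k < length es")
    case True
    moreover from this have "k - 1 < length es" by simp
    ultimately have "collider (es @ [e]) k = collider es k"
      by (simp add: collider_def nth_append)
    then show ?thesis using w len \<open>k < length es\<close> k by (simp add: m_walk_def nth_append)
  next
    case False
    then have kl: "k = length es" using that by simp
    with k have ne: "es \<noteq> []" by auto
    have "collider (es @ [e]) k \<longleftrightarrow> last es \<in> {Fwd, Bidir} \<and> e \<in> {Bwd, Bidir}"
      using ne kl by (auto simp: collider_def nth_append last_conv_nth)
    moreover have "(vs @ [w]) ! k = last vs" using kl len lastvs by (simp add: nth_append)
    ultimately show ?thesis using inner[OF ne] by simp
  qed
  show ?thesis unfolding m_walk_def using joins cond len by simp
qed

text \<open>Each rule of \<open>m_reach\<close> appends one edge. The flag is tied to the last edge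
  because it decides whether the old end vertex becomes a collider; the trivial walk has no
  arrowhead at its end.\<close>

lemma m_reach_imp_m_walk:
  assumes "m_reach G X Z v h"
  shows "\<exists>vs es. m_walk G Z vs es \<and> hd vs \<in> X \<and> last vs = v \<and>
           h = (es \<noteq> [] \<and> last es \<in> {Fwd, Bidir})"
  using assms
proof induction
  case (start x)
  then have "m_walk G Z [x] [] \<and> hd [x] \<in> X \<and> last [x] = x \<and>
    False = ([] \<noteq> [] \<and> last [] \<in> {Fwd, Bidir})" by (simp add: m_walk_def)
  then show ?case by blast
next
  case (noncollider v h e w)
  then obtain vs es where *: "m_walk G Z vs es" "hd vs \<in> X" "last vs = v"
    "h = (es \<noteq> [] \<and> last es \<in> {Fwd, Bidir})" by blast
  have "vs \<noteq> []" using *(1) by (auto simp: m_walk_def)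
  moreover have "m_walk G Z (vs @ [w]) (es @ [e])"
    using noncollider * by (intro m_walk_extend) auto
  ultimately show ?case using *
    by (intro exI[of _ "vs @ [w]"] exI[of _ "es @ [e]"]) auto
next
  case (collider v e w)
  then obtain vs es where *: "m_walk G Z vs es" "hd vs \<in> X" "last vs = v"
    "True = (es \<noteq> [] \<and> last es \<in> {Fwd, Bidir})" by blast
  have "vs \<noteq> []" using *(1) by (auto simp: m_walk_def)
  moreover have "m_walk G Z (vs @ [w]) (es @ [e])"
    using collider * by (intro m_walk_extend) auto
  ultimately show ?case using *
    by (intro exI[of _ "vs @ [w]"] exI[of _ "es @ [e]"]) auto
qed

text \<open>Follow the walk from a vertex that it leaves forwards: the first step that is not forwards
  makes a collider.\<close>

lemma m_walk_fwd_descendants: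
  assumes w: "m_walk G Z vs es" and "i < j" "j \<le> length es" and "es ! i = Fwd"
    and "es ! (j - 1) \<noteq> Fwd"
  shows "descendants G (vs ! i) \<inter> Z \<noteq> {}"
proof -
  have joins: "joins G (vs ! k) (es ! k) (vs ! (k + 1))" if "k < length es" for k
    using w that by (simp add: m_walk_def)
  have inner: "if collider es k then descendants G (vs ! k) \<inter> Z \<noteq> {} else vs ! k \<notin> Z"
    if "0 < k" "k < length es" for k
    using w that unfolding m_walk_def by blast
  show ?thesis using assms(2-)
  proof (induction "j - i" arbitrary: i rule: less_induct)
    case less
    have ij: "i + 1 < j"
    proof (rule ccontr)
      assume "\<not> i + 1 < j"
      then have "i = j - 1" using less.prems by simp
      then show False using less.prems by simp
    qed
    have edge: "(vs ! i, vs ! (i + 1)) \<in> dir G"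
      using joins[of i] less.prems by simp
    have "descendants G (vs ! (i + 1)) \<inter> Z \<noteq> {}"
    proof (cases "es ! (i + 1) = Fwd")
      case True
      then show ?thesis using less.hyps[of "i + 1"] less.prems ij by simp
    next
      case False
      then have "es ! (i + 1) \<in> {Bwd, Bidir}" by (cases "es ! (i + 1)") auto
      then have "collider es (i + 1)" using less.prems by (simp add: collider_def)
      then show ?thesis using inner[of "i + 1"] ij less.prems by simp
    qed
    then show ?case using edge
      by (auto simp: descendants_def intro: converse_rtrancl_into_rtrancl)
  qed
qed

text \<open>The loop between two visits of a vertex is cut out, and only the junction gets a new
  pair of adjacent edges. If it becomes a collider although neither visit was one, the loop leaves
  the vertex forwards and returns by a step that is not forwards. So the loop contains a collider
  descending from the vertex, which supplies the descendant in \<open>Z\<close>.\<close>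

lemma m_walk_shortcut:
  assumes w: "m_walk G Z vs es" and ij: "i < j" "j \<le> length es" and eq: "vs ! i = vs ! j"
  defines "vs' \<equiv> take (i + 1) vs @ drop (j + 1) vs" and "es' \<equiv> take i es @ drop j es"
  shows "m_walk G Z vs' es'" "hd vs' = hd vs" "last vs' = last vs" "length es' < length es"
proof -
  have len: "length vs = length es + 1" using w by (simp add: m_walk_def)
  have joins: "joins G (vs ! k) (es ! k) (vs ! (k + 1))" if "k < length es" for k
    using w that by (simp add: m_walk_def)
  have inner: "if collider es k then descendants G (vs ! k) \<inter> Z \<noteq> {} else vs ! k \<notin> Z"
    if "0 < k" "k < length es" for k
    using w that unfolding m_walk_def by blast
  have vs'1: "vs' ! k = vs ! k" if "k \<le> i" for k
    using that ij len by (simp add: vs'_def nth_append)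
  \<comment> \<open>At \<open>k = i\<close> both descriptions of the shortened list apply; they
    agree because the vertices at \<open>i\<close> and \<open>j\<close> coincide.\<close>
  have vs'2: "vs' ! k = vs ! (k - i + j)" if "k \<ge> i" "k - i + j \<le> length es" for k
  proof (cases "k = i")
    case True
    then show ?thesis using vs'1[of i] eq by simp
  next
    case False
    then have "j + 1 + (k - (i + 1)) = k - i + j" using that by simp
    then show ?thesis using False that ij len by (simp add: vs'_def nth_append)
  qed
  have es'1: "es' ! k = es ! k" if "k < i" for k
    using that ij by (simp add: es'_def nth_append)
  have es'2: "es' ! k = es ! (k - i + j)" if "k \<ge> i" "k - i + j < length es" for k
    using that ij by (simp add: es'_def nth_append add.commute)
  have lenes': "length es' = length es - (j - i)" using ij by (simp add: es'_def)
  have lenvs': "length vs' = length es' + 1" using ij len by (simp add: vs'_def es'_def)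
  show "length es' < length es" using lenes' ij by simp
  have vsne: "vs \<noteq> []" using len by auto
  show "hd vs' = hd vs" using vsne by (cases vs) (auto simp: vs'_def)
  show "last vs' = last vs"
  proof -
    have "last vs' = vs' ! length es'" using lenvs' by (subst last_conv_nth) auto
    also have "\<dots> = vs ! length es" using vs'2[of "length es'"] lenes' ij by simp
    also have "\<dots> = last vs" using len vsne by (simp add: last_conv_nth)
    finally show ?thesis .
  qed
  have joins': "joins G (vs' ! k) (es' ! k) (vs' ! (k + 1))" if k: "k < length es'" for k
  proof (cases "k < i")
    case True
    then show ?thesis using joins[of k] vs'1[of k] vs'1[of "k + 1"] es'1[of k] ij by simp
  next
    case False
    then have "k - i + j < length es" using k lenes' ij by simp
    then show ?thesis
      using joins[of "k - i + j"] vs'2[of k] vs'2[of "k + 1"] es'2[of k] False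
      by (simp add: Suc_diff_le)
  qed
  have inner': "if collider es' k then descendants G (vs' ! k) \<inter> Z \<noteq> {} else vs' ! k \<notin> Z"
    if k: "0 < k" "k < length es'" for k
  proof -
    consider "k < i" | "k = i" | "k > i" by linarith
    then show ?thesis
    proof cases
      case 1
      then have "collider es' k = collider es k" by (simp add: collider_def es'1)
      then show ?thesis using inner[of k] vs'1[of k] 1 k ij by simp
    next
      case 3
      then have kj: "k - i + j < length es" using k lenes' ij by simp
      have "es' ! (k - 1) = es ! (k - i + j - 1)"
        using es'2[of "k - 1"] 3 kj by (simp add: Suc_leI)
      then have col: "collider es' k = collider es (k - i + j)"
        using es'2[of k] 3 kj by (simp add: collider_def)
      have v: "vs' ! k = vs ! (k - i + j)" using vs'2[of k] 3 kj by simp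
      have "0 < k - i + j" using ij by simp
      then show ?thesis unfolding col v using kj by (rule inner)
    next
      case 2
      have jl: "j < length es" using k lenes' 2 ij by simp
      have col': "collider es' k \<longleftrightarrow> es ! (i - 1) \<in> {Fwd, Bidir} \<and> es ! j \<in> {Bwd, Bidir}"
        using es'1[of "k - 1"] es'2[of k] 2 k jl by (simp add: collider_def)
      have v: "vs' ! k = vs ! i" using vs'1 2 by simp
      have ii: "if collider es i then descendants G (vs ! i) \<inter> Z \<noteq> {} else vs ! i \<notin> Z"
        using inner[of i] 2 k ij by simp
      have jj: "if collider es j then descendants G (vs ! i) \<inter> Z \<noteq> {} else vs ! i \<notin> Z"
        using inner[of j] jl ij eq by simp
      show ?thesis
      \<comment> \<open>If exactly one visit is a collider, both conditions are known for the
        vertex; if both are, the junction is a collider too.\<close>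
      proof (cases "collider es i \<or> collider es j")
        case True
        then show ?thesis using ii jj col' v
          by (auto simp: collider_def split: if_splits)
      next
        case False
        then have nZ: "vs ! i \<notin> Z" using ii by simp
        show ?thesis
        proof (cases "collider es' k")
          case True
          have "es ! i = Fwd"
            using False True col' by (cases "es ! i") (auto simp: collider_def)
          moreover have "es ! (j - 1) \<noteq> Fwd"
            using False True col' by (auto simp: collider_def)
          ultimately have "descendants G (vs ! i) \<inter> Z \<noteq> {}"
            using m_walk_fwd_descendants[OF w] ij by blast
          then show ?thesis using True v by simp
        qed (use nZ v in simp)
      qed
    qed
  qed
  show "m_walk G Z vs' es'" unfolding m_walk_def using lenvs' joins' inner' by blast
qed

text \<open>Every cut of a loop shortens the walk and keeps its ends, so the cutting stops at
  distinct vertices.\<close>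

lemma m_walk_imp_path:
  assumes "m_walk G Z vs es"
  shows "\<exists>vs' es'. is_path G vs' es' \<and> hd vs' = hd vs \<and> last vs' = last vs \<and>
           \<not> blocked G Z vs' es'"
  using assms
proof (induction "length es" arbitrary: vs es rule: less_induct)
  case less
  have len: "length vs = length es + 1" using less.prems by (simp add: m_walk_def)
  show ?case
  proof (cases "distinct vs")
    case True
    then have "is_path G vs es" using less.prems by (simp add: is_path_def m_walk_def)
    moreover have "\<not> blocked G Z vs es"
      using less.prems by (auto simp: blocked_def m_walk_def)
    ultimately show ?thesis by blast
  next
    case False
    then obtain i j where "i < length vs" "j < length vs" "i \<noteq> j" "vs ! i = vs ! j"
      by (auto simp: distinct_conv_nth)
    then obtain i j where ij: "i < j" "j \<le> length es" "vs ! i = vs ! j"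
      using len by (cases i j rule: linorder_cases) force+
    note cut = m_walk_shortcut[OF less.prems ij]
    show ?thesis using less.hyps[OF cut(4,1)] cut(2,3) by simp
  qed
qed

lemma m_separated_imp_not_m_reach:
  assumes "m_separated G X Y Z" "y \<in> Y"
  shows "\<not> m_reach G X Z y h"
proof
  assume "m_reach G X Z y h"
  from m_reach_imp_m_walk[OF this] obtain vs es
    where w: "m_walk G Z vs es" "hd vs \<in> X" "last vs = y" by auto
  from m_walk_imp_path[OF w(1)] obtain vs' es'
    where "is_path G vs' es'" "hd vs' = hd vs" "last vs' = last vs" "\<not> blocked G Z vs' es'"
    by auto
  then show False using assms w unfolding m_separated_def by metis
qed

section \<open>Ancestral sets and the two sides of a separation\<close>

definition ancestors :: "'v mixed_graph \<Rightarrow> 'v set \<Rightarrow> 'v set" where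
  "ancestors G X = {v. descendants G v \<inter> X \<noteq> {}}"

lemma descendants_edge: "(v, w) \<in> dir G \<Longrightarrow> descendants G w \<subseteq> descendants G v"
  by (auto simp: descendants_def intro: converse_rtrancl_into_rtrancl)

text \<open>A directed path into \<open>X\<close> is traversed backwards. Its vertices descend from
  \<open>v\<close>, hence avoid \<open>Z\<close>, and are passed as non-colliders.\<close>

lemma m_reach_up:
  assumes "(v, x) \<in> (dir G)\<^sup>*" "x \<in> X" "descendants G v \<inter> Z = {}"
  shows "m_reach G X Z v False"
  using assms
proof (induction rule: converse_rtrancl_induct)
  case base
  then show ?case by (simp add: m_reach.start)
next
  case (step v w)
  have "descendants G w \<inter> Z = {}" using step descendants_edge by fastforce
  then have "m_reach G X Z w False" "w \<notin> Z"
    using step by (auto simp: descendants_def)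
  then have "m_reach G X Z v (Bwd \<in> {Fwd, Bidir})"
    using step.hyps(1) by (intro m_reach.noncollider) auto
  then show ?case by simp
qed

lemma m_reach_down:
  assumes "(v, y) \<in> (dir G)\<^sup>*" "m_reach G X Z v h" "descendants G v \<inter> Z = {}"
  shows "\<exists>h'. m_reach G X Z y h'"
  using assms
proof (induction arbitrary: h rule: converse_rtrancl_induct)
  case (step v w)
  have "v \<notin> Z" using step.prems by (auto simp: descendants_def)
  then have "m_reach G X Z w (Fwd \<in> {Fwd, Bidir})"
    using step by (intro m_reach.noncollider[where v = v]) auto
  then show ?case using step.IH step.hyps(1) step.prems(2) descendants_edge by fastforce
qed auto

text \<open>The set \<open>K\<close> collects the vertices whose structural equation is attached to the side of \<open>X\<close>.
  A vertex of \<open>Z\<close> belongs to it if it is entered through an arrowhead.\<close>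

lemma m_separated_partition:
  fixes G :: "'v mixed_graph"
  assumes sep: "m_separated G X Y Z" and XZ: "X \<inter> Z = {}"
  defines "W \<equiv> ancestors G (X \<union> Y \<union> Z)"
  obtains K where "K \<subseteq> W" "X \<subseteq> K" "Y \<inter> K = {}"
    and "\<And>v w. v \<in> K \<Longrightarrow> (w, v) \<in> dir G \<Longrightarrow> w \<notin> Z \<Longrightarrow> w \<in> K"
    and "\<And>v w. w \<in> K \<Longrightarrow> w \<notin> Z \<Longrightarrow> (w, v) \<in> dir G \<Longrightarrow> v \<in> W \<Longrightarrow> v \<in> K"
    and "\<And>v w. v \<in> K \<Longrightarrow> (v, w) \<in> bidir G \<Longrightarrow> w \<in> W \<Longrightarrow> w \<in> K"
proof -
  define K where "K = {v \<in> W. m_reach G X Z v True \<or> (v \<notin> Z \<and> m_reach G X Z v False)}"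
  have noY: "\<not> m_reach G X Z y h" if "y \<in> Y" for y h
    using m_separated_imp_not_m_reach[OF sep that] .
  \<comment> \<open>From a vertex of \<open>K\<close> one can always continue against an arrow or
    along a bi-directed edge. The critical case is a vertex entered by an arrowhead without
    descendants in \<open>Z\<close>: it is an ancestor of \<open>X\<close> or \<open>Y\<close>,
    going down to \<open>Y\<close> is excluded by the separation, so it lies above \<open>X\<close>
    and is reached from there through a tail.\<close>
  have bw: "m_reach G X Z w (e \<in> {Fwd, Bidir})"
    if v: "v \<in> K" and e: "e \<in> {Bwd, Bidir}" and j: "joins G v e w" for v e w
  proof (cases "v \<notin> Z \<and> m_reach G X Z v False")
    case True
    then show ?thesis using m_reach.noncollider[of G X Z v False e w] j by simp
  next
    case False
    then have r: "m_reach G X Z v True" using v by (auto simp: K_def)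
    show ?thesis
    proof (cases "descendants G v \<inter> Z = {}")
      case True
      then have vZ: "v \<notin> Z" by (auto simp: descendants_def)
      obtain x where x: "x \<in> X \<union> Y" "(v, x) \<in> (dir G)\<^sup>*"
        using v True by (auto simp: K_def W_def ancestors_def descendants_def)
      have "x \<notin> Y" using m_reach_down[OF x(2) r True] noY by blast
      then have "m_reach G X Z v False" using m_reach_up[OF x(2) _ True] x(1) by blast
      then show ?thesis using False vZ by blast
    next
      case False
      then show ?thesis using m_reach.collider[OF r _ j e] by simp
    qed
  qed
  have W_anc: "w \<in> W" if "(w, v) \<in> dir G" "v \<in> W" for v w
    using that descendants_edge unfolding W_def ancestors_def by fastforce
  have W_sup: "X \<union> Y \<union> Z \<subseteq> W"
    by (auto simp: W_def ancestors_def descendants_def)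
  show ?thesis
  proof
    show "K \<subseteq> W" by (auto simp: K_def)
    show "X \<subseteq> K" using W_sup XZ by (auto simp: K_def intro: m_reach.start)
    show "Y \<inter> K = {}" using noY by (auto simp: K_def)
    show "w \<in> K" if "v \<in> K" "(w, v) \<in> dir G" "w \<notin> Z" for v w
      using bw[OF that(1), of Bwd w] that W_anc by (auto simp: K_def)
    show "v \<in> K" if "w \<in> K" "w \<notin> Z" "(w, v) \<in> dir G" "v \<in> W" for v w
    proof -
      have "\<exists>h. m_reach G X Z w h" using that(1) by (auto simp: K_def)
      then obtain h where "m_reach G X Z w h" ..
      from m_reach.noncollider[OF this \<open>w \<notin> Z\<close>, of Fwd v] that show ?thesis by (auto simp: K_def)
    qed
    show "w \<in> K" if "v \<in> K" "(v, w) \<in> bidir G" "w \<in> W" for v w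
      using bw[OF that(1), of Bidir w] that by (auto simp: K_def)
  qed
qed

section \<open>Power series inverse of the autoregressive polynomial\<close>

lemma holomorphic_on_det:
  fixes M :: "complex \<Rightarrow> complex^'n^'n"
  assumes "\<And>i j. (\<lambda>z. M z $ i $ j) holomorphic_on U"
  shows "(\<lambda>z. det (M z)) holomorphic_on U"
  unfolding det_def by (intro holomorphic_on_sum holomorphic_on_mult holomorphic_on_const
      holomorphic_on_prod assms)

text \<open>The compact ball has positive distance to the complement of \<open>U\<close>, and a
  point slightly outside the ball is close to its radial projection. The extra radius later puts the
  point 1 inside a disc of convergence.\<close>

lemma cball_subset_open_imp_larger_ball:
  fixes U :: "'a::euclidean_space set"
  assumes "open U" "cball 0 1 \<subseteq> U"
  obtains r where "r > 1" "ball 0 r \<subseteq> U"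
proof -
  have "compact (cball (0::'a) 1)" "closed (- U)" "cball 0 1 \<inter> - U = {}"
    using assms by (auto simp: open_closed)
  then obtain d where d: "d > 0" "\<And>x y. x \<in> cball 0 1 \<Longrightarrow> y \<in> - U \<Longrightarrow> d \<le> dist x y"
    using separate_compact_closed by metis
  have "z \<in> U" if z: "z \<in> ball 0 (1 + d)" for z
  proof (rule ccontr)
    assume zU: "z \<notin> U"
    have z1: "norm z > 1"
    proof (rule ccontr)
      assume "\<not> norm z > 1"
      then have "z \<in> cball 0 1" by simp
      then show False using zU assms(2) by blast
    qed
    then have z0: "z \<noteq> 0" by auto
    have "z /\<^sub>R norm z - z = (1 / norm z - 1) *\<^sub>R z"
      by (simp add: algebra_simps divide_inverse)
    then have "dist (z /\<^sub>R norm z) z = \<bar>1 / norm z - 1\<bar> * norm z"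
      by (simp add: dist_norm)
    also have "\<dots> = norm z - 1" using z1 by (auto simp: abs_if field_simps)
    finally have "dist (z /\<^sub>R norm z) z < d" using z by simp
    moreover have "z /\<^sub>R norm z \<in> cball 0 1" using z0 by simp
    ultimately show False using d(2)[of "z /\<^sub>R norm z" z] zU by simp
  qed
  then have "ball 0 (1 + d) \<subseteq> U" by blast
  then show ?thesis using that[of "1 + d"] d(1) by simp
qed

text \<open>The determinant does not vanish on the closed unit disc, so the entries of the inverse
  are holomorphic on a disc of radius \<open>r > 1\<close>. Their Taylor coefficients give
  \<open>\<Psi>\<close>, and comparing coefficients in the product with the polynomial gives the
  convolution identity.\<close>

lemma matrix_power_series_inverse:
  fixes P :: "nat \<Rightarrow> real^'n^'n"
  assumes P0: "\<And>k. k > p \<Longrightarrow> P k = 0"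
    and det: "\<And>z. cmod z \<le> 1 \<Longrightarrow>
      det (\<chi> i j. \<Sum>k\<le>p. complex_of_real (P k $ i $ j) * z ^ k) \<noteq> 0"
  obtains \<Psi> :: "nat \<Rightarrow> real^'n^'n"
  where "\<And>i j. (\<lambda>k. \<Psi> k $ i $ j) \<longlonglongrightarrow> 0"
    and "\<And>n. (\<Sum>l\<le>n. \<Psi> l ** P (n - l)) = (if n = 0 then mat 1 else 0)"
proof -
  define Q where "Q z = (\<chi> i j. \<Sum>k\<le>p. complex_of_real (P k $ i $ j) * z ^ k)" for z
  define U where "U = {z. det (Q z) \<noteq> 0}"
  have Qholo: "(\<lambda>z. Q z $ i $ j) holomorphic_on V" for i j V
    unfolding Q_def by (auto intro!: holomorphic_intros)
  have detholo: "(\<lambda>z. det (Q z)) holomorphic_on V" for V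
    by (intro holomorphic_on_det Qholo)
  have "open U" unfolding U_def
    by (intro open_Collect_neq continuous_on_const holomorphic_on_imp_continuous_on[OF detholo])
  moreover have "cball 0 1 \<subseteq> U" using det by (auto simp: U_def Q_def)
  ultimately obtain r where r: "r > 1" "ball 0 r \<subseteq> U"
    using cball_subset_open_imp_larger_ball by blast
  \<comment> \<open>Cramer's rule writes the entries of the inverse as quotients of holomorphic
    functions.\<close>
  define F where "F z = (\<chi> k m. det (\<chi> i j. if j = k then (axis m 1 :: complex^'n) $ i else Q z $ i $ j)
                                / det (Q z))" for z
  have inv: "F z ** Q z = mat 1" if "z \<in> U" for z
  proof -
    have dz: "det (Q z) \<noteq> 0" using that by (simp add: U_def)
    have "Q z *v column m (F z) = axis m 1" for m
      unfolding cramer[OF dz] by (simp add: F_def column_def)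
    then have "Q z ** F z = mat 1"
      by (simp add: vec_eq_iff matrix_matrix_mult_def matrix_vector_mult_def column_def mat_def axis_def)
    then show ?thesis by (simp add: matrix_left_right_inverse)
  qed
  have Fholo: "(\<lambda>z. F z $ k $ m) holomorphic_on ball 0 r" for k m
  proof -
    have "(\<lambda>z. det (\<chi> i j. if j = k then (axis m 1 :: complex^'n) $ i else Q z $ i $ j) / det (Q z))
        holomorphic_on ball 0 r"
    proof (intro holomorphic_on_divide detholo holomorphic_on_det)
      show "(\<lambda>z. (\<chi> i j. if j = k then (axis m 1 :: complex^'n) $ i else Q z $ i $ j) $ i $ j)
          holomorphic_on ball 0 r" for i j
        using Qholo[of i j] by (cases "j = k") auto
      show "det (Q z) \<noteq> 0" if "z \<in> ball 0 r" for z using r that by (auto simp: U_def)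
    qed
    then show ?thesis by (simp add: F_def)
  qed
  define f where "f k m = fps_expansion (\<lambda>z. F z $ k $ m) 0" for k m
  have fexp: "(\<lambda>z. F z $ k $ m) has_fps_expansion f k m" for k m
    unfolding f_def using r by (intro has_fps_expansion_fps_expansion[OF _ _ Fholo]) auto
  define q where "q i j = (\<Sum>k\<le>p. fps_const (complex_of_real (P k $ i $ j)) * fps_X ^ k)" for i j
  have qexp: "(\<lambda>z. Q z $ i $ j) has_fps_expansion q i j" for i j
    unfolding Q_def q_def by (auto intro!: fps_expansion_intros has_fps_expansion_sum)
  have qnth: "fps_nth (q i j) n = complex_of_real (P n $ i $ j)" for i j n
  proof -
    have "fps_nth (q i j) n = (\<Sum>k\<le>p. if n = k then complex_of_real (P k $ i $ j) else 0)"
      unfolding q_def fps_sum_nth by (intro sum.cong) (auto simp: fps_X_power_nth)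
    also have "\<dots> = complex_of_real (P n $ i $ j)" using P0[of n] by (auto simp: sum.delta)
    finally show ?thesis .
  qed
  have conv: "(\<lambda>n. fps_nth (f i j) n) \<longlonglongrightarrow> 0" for i j
  proof -
    have "(\<lambda>z. F z $ i $ j) holomorphic_on eball 0 (ereal r)"
      using Fholo[of i j] by simp
    \<comment> \<open>The series is evaluated at 1, inside the disc because \<open>r > 1\<close>;
      the terms of a convergent series tend to zero.\<close>
    then have "(\<lambda>n. fps_nth (f i j) n * 1 ^ n) sums (F 1 $ i $ j)"
      using r by (intro has_fps_expansion_imp_sums_complex[OF fexp, where r = "ereal r"]) auto
    then show ?thesis by (simp add: sums_iff summable_LIMSEQ_zero)
  qed
  have prod: "(\<Sum>m\<in>UNIV. f i m * q m j) = (if i = j then 1 else 0)" for i j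
  proof -
    have "(\<lambda>z. \<Sum>m\<in>UNIV. F z $ i $ m * Q z $ m $ j) has_fps_expansion (\<Sum>m\<in>UNIV. f i m * q m j)"
      by (intro has_fps_expansion_sum has_fps_expansion_mult fexp qexp)
    moreover have "(\<Sum>m\<in>UNIV. F z $ i $ m * Q z $ m $ j) = (if i = j then 1 else 0)" if "z \<in> ball 0 r" for z
    proof -
      have "F z ** Q z = mat 1" using inv r that by auto
      then have "(F z ** Q z) $ i $ j = mat 1 $ i $ j" by simp
      then show ?thesis by (simp add: matrix_matrix_mult_def mat_def)
    qed
    then have "\<forall>\<^sub>F z in nhds 0. (\<Sum>m\<in>UNIV. F z $ i $ m * Q z $ m $ j) = (if i = j then 1 else 0)"
      using r by (intro eventually_mono[OF eventually_nhds_in_open[of "ball 0 r"]]) auto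
    ultimately have "(\<lambda>_. if i = j then 1 else 0) has_fps_expansion (\<Sum>m\<in>UNIV. f i m * q m j)"
      by (subst (asm) has_fps_expansion_cong[OF _ refl])
    moreover have "(\<lambda>_. if i = j then 1 else 0) has_fps_expansion (if i = j then 1 else (0::complex fps))"
      by auto
    ultimately show ?thesis by (rule fps_expansion_unique_complex)
  qed
  \<comment> \<open>As \<open>P\<close> is real, the convolution identity is preserved by taking
    real parts of the coefficients.\<close>
  define \<Psi> where "\<Psi> k = (\<chi> i j. Re (fps_nth (f i j) k))" for k
  have "(\<lambda>k. \<Psi> k $ i $ j) \<longlonglongrightarrow> 0" for i j
    using tendsto_Re[OF conv[of i j]] by (simp add: \<Psi>_def)
  moreover have "(\<Sum>l\<le>n. \<Psi> l ** P (n - l)) = (if n = 0 then mat 1 else 0)" for n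
  proof (subst vec_eq_iff, intro allI, subst vec_eq_iff, intro allI)
    fix i j
    have "fps_nth (\<Sum>m\<in>UNIV. f i m * q m j) n = fps_nth (if i = j then 1 else 0) n"
      by (simp only: prod)
    then have "(\<Sum>m\<in>UNIV. \<Sum>l\<le>n. fps_nth (f i m) l * complex_of_real (P (n - l) $ m $ j))
        = (if i = j \<and> n = 0 then 1 else 0)"
      by (simp add: fps_sum_nth fps_mult_nth qnth atLeast0AtMost split: if_splits)
    then have "Re (\<Sum>m\<in>UNIV. \<Sum>l\<le>n. fps_nth (f i m) l * complex_of_real (P (n - l) $ m $ j))
        = (if i = j \<and> n = 0 then 1 else 0)" by simp
    then have "(\<Sum>m\<in>UNIV. \<Sum>l\<le>n. \<Psi> l $ i $ m * P (n - l) $ m $ j) = (if i = j \<and> n = 0 then 1 else 0)"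
      by (simp add: \<Psi>_def)
    then show "(\<Sum>l\<le>n. \<Psi> l ** P (n - l)) $ i $ j = (if n = 0 then mat 1 else 0) $ i $ j"
      by (subst (asm) sum.swap) (auto simp: matrix_matrix_mult_def mat_def)
  qed
  ultimately show ?thesis using that by blast
qed

section \<open>Acyclicity, stability and the non-vanishing of the determinant\<close>

lemma wf_instantaneous:
  fixes A :: "nat \<Rightarrow> real^'d^'d"
  assumes "acyclic (full_time_edges p q A B)"
  shows "wf {(j, i). A 0 $ i $ j \<noteq> 0}" "wf ({(j, i). A 0 $ i $ j \<noteq> 0}\<inverse>)"
proof -
  let ?r = "{(j, i). A 0 $ i $ j \<noteq> 0}"
  \<comment> \<open>Instantaneous edges are copied into the time slice 0, so a cycle among them
    would be a cycle of the full-time graph.\<close>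
  have "(Endo (0, j), Endo (0, i)) \<in> (full_time_edges p q A B)\<^sup>+" if "(j, i) \<in> ?r\<^sup>+" for i j
    using that
  proof induction
    case (base y)
    then show ?case by (auto simp: full_time_edges_def intro!: r_into_trancl exI[of _ 0])
  next
    case (step y z)
    have "(Endo (0, y), Endo (0, z)) \<in> full_time_edges p q A B"
      using step.hyps(2) by (auto simp: full_time_edges_def intro!: exI[of _ 0])
    then show ?case using step.IH by (rule trancl_into_trancl[rotated])
  qed
  then have ac: "acyclic ?r" using assms unfolding acyclic_def by blast
  have fin: "finite ?r" by simp
  show "wf ?r" "wf (?r\<inverse>)"
    using finite_acyclic_wf[OF fin ac] finite_acyclic_wf_converse[OF fin ac] by auto
qed

lemma det_nonzero_iff_kernel:
  fixes M :: "'a::field^'n^'n"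
  shows "det M \<noteq> 0 \<longleftrightarrow> (\<forall>x. M *v x = 0 \<longrightarrow> x = 0)"
  by (metis invertible_det_nz invertible_left_inverse matrix_left_invertible_ker)

text \<open>For \<open>z \<noteq> 0\<close> the matrix is \<open>z ^ p\<close> times the stability
  matrix at \<open>1 / z\<close>, a point outside the open unit disc. This substitution misses 0,
  where the matrix is \<open>I - A 0\<close>; its kernel is trivial because the instantaneous graph
  is acyclic.\<close>

lemma det_stable_nonzero:
  fixes A :: "nat \<Rightarrow> real^'d^'d"
  assumes acyclic: "acyclic (full_time_edges p q A B)"
    and stable: "\<And>z. det (\<chi> i j. complex_of_real ((mat 1 - A 0) $ i $ j) * z ^ p
                   - (\<Sum>k=1..p. complex_of_real (A k $ i $ j) * z ^ (p - k))) = 0 \<Longrightarrow> cmod z < 1"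
    and z: "cmod z \<le> 1"
  shows "det (\<chi> i j. \<Sum>k\<le>p. complex_of_real ((if k = 0 then mat 1 - A 0 else - A k) $ i $ j) * z ^ k) \<noteq> 0"
    (is "det ?Q \<noteq> 0")
proof (cases "z = 0")
  case True
  have Q: "?Q $ i $ j = complex_of_real ((mat 1 - A 0) $ i $ j)" for i j
    using True by (simp add: power_0_left if_distrib[of "\<lambda>x. _ * x"] sum.delta cong: if_cong)
  show ?thesis unfolding det_nonzero_iff_kernel
  proof (intro allI impI)
    fix x assume x: "?Q *v x = 0"
    have eq: "x $ i = (\<Sum>j\<in>UNIV. complex_of_real (A 0 $ i $ j) * x $ j)" for i
    proof -
      have "0 = (?Q *v x) $ i" using x by simp
      also have "\<dots> = (\<Sum>j\<in>UNIV. ?Q $ i $ j * x $ j)" by (simp add: matrix_vector_mult_def)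
      also have "\<dots> = (\<Sum>j\<in>UNIV. (if i = j then x $ j else 0) - complex_of_real (A 0 $ i $ j) * x $ j)"
        unfolding Q by (intro sum.cong) (auto simp: mat_def algebra_simps)
      also have "\<dots> = x $ i - (\<Sum>j\<in>UNIV. complex_of_real (A 0 $ i $ j) * x $ j)"
        by (simp add: sum_subtractf)
      finally show ?thesis by simp
    qed
    \<comment> \<open>Well-founded induction along instantaneous edges: a coordinate vanishes once
      those of its parents do.\<close>
    have "x $ i = 0" for i
      using wf_instantaneous(1)[OF acyclic]
    proof (induction i)
      case (less i)
      have "complex_of_real (A 0 $ i $ j) * x $ j = 0" for j
        using less[of j] by (cases "A 0 $ i $ j = 0") auto
      then show ?case by (subst eq, intro sum.neutral) simp
    qed
    then show "x = 0" by (simp add: vec_eq_iff)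
  qed
next
  case False
  have scaled: "N *v x = c *s (L *v x)" if "\<And>i j. N $ i $ j = c * L $ i $ j"
    for N L :: "complex^'d^'d" and c x
    using that by (simp add: vec_eq_iff matrix_vector_mult_def sum_distrib_left mult.assoc)
  let ?R = "\<chi> i j. complex_of_real ((mat 1 - A 0) $ i $ j) * (1 / z) ^ p
                   - (\<Sum>k=1..p. complex_of_real (A k $ i $ j) * (1 / z) ^ (p - k))"
  have R: "?R $ i $ j = (1 / z) ^ p * ?Q $ i $ j" for i j
  proof -
    have "(\<Sum>k\<le>p. complex_of_real ((if k = 0 then mat 1 - A 0 else - A k) $ i $ j) * z ^ k)
      = complex_of_real ((mat 1 - A 0) $ i $ j) - (\<Sum>k=1..p. complex_of_real (A k $ i $ j) * z ^ k)"
      by (simp add: atMost_atLeast0 sum.atLeast_Suc_atMost sum_negf)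
    then have Q: "?Q $ i $ j = complex_of_real ((mat 1 - A 0) $ i $ j)
        - (\<Sum>k=1..p. complex_of_real (A k $ i $ j) * z ^ k)" by simp
    have "(1 / z) ^ (p - k) = (1 / z) ^ p * z ^ k" if "k \<in> {1..p}" for k
      using that False by (simp add: power_diff power_one_over field_simps)
    then have "(\<Sum>k=1..p. complex_of_real (A k $ i $ j) * (1 / z) ^ (p - k))
        = (\<Sum>k=1..p. (1 / z) ^ p * (complex_of_real (A k $ i $ j) * z ^ k))"
      by (intro sum.cong) auto
    then have "?R $ i $ j = complex_of_real ((mat 1 - A 0) $ i $ j) * (1 / z) ^ p
        - (\<Sum>k=1..p. (1 / z) ^ p * (complex_of_real (A k $ i $ j) * z ^ k))" by simp
    then show ?thesis unfolding Q
      by (simp only: right_diff_distrib sum_distrib_left mult.commute)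
  qed
  have "1 \<le> cmod (1 / z)" using z False by (simp add: norm_divide)
  then have "det ?R \<noteq> 0" using stable[of "1 / z"] by fastforce
  \<comment> \<open>Comparing kernels avoids the power of \<open>1 / z\<close> that would appear
    between the determinants.\<close>
  moreover have "?R *v x = ((1 / z) ^ p) *s (?Q *v x)" for x
    using scaled[of ?R _ ?Q] R by blast
  ultimately show ?thesis unfolding det_nonzero_iff_kernel by auto
qed

text \<open>The window has at most \<open>j\<close> terms, so it is a sum of a fixed number of
  shifted null sequences. The truncation of \<open>n - j\<close> at 0 affects only finitely many
  \<open>n\<close>.\<close>

lemma sum_window_tendsto_0:
  fixes a :: "nat \<Rightarrow> real"
  assumes "a \<longlonglongrightarrow> 0"
  shows "(\<lambda>n. \<Sum>k\<in>{n - j..<n}. a k) \<longlonglongrightarrow> 0"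
proof -
  have "(\<lambda>n. a (n - Suc i)) \<longlonglongrightarrow> 0" for i
    by (rule filterlim_compose[OF assms filterlim_minus_const_nat_at_top])
  then have "(\<lambda>n. \<Sum>i<j. a (n - Suc i)) \<longlonglongrightarrow> 0" by (intro tendsto_null_sum)
  moreover have "(\<Sum>i<j. a (n - Suc i)) = (\<Sum>k\<in>{n - j..<n}. a k)" if "j \<le> n" for n
    by (rule sum.reindex_bij_witness[of _ "\<lambda>k. n - Suc k" "\<lambda>i. n - Suc i"]) (use that in auto)
  then have "\<forall>\<^sub>F n in sequentially. (\<Sum>i<j. a (n - Suc i)) = (\<Sum>k\<in>{n - j..<n}. a k)"
    unfolding eventually_sequentially by blast
  ultimately show ?thesis by (rule Lim_transform_eventually)
qed

section \<open>Linear filters and their truncated inverses\<close>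

lemma matrix_vector_mult_sum_right: "C *v (\<Sum>i\<in>I. f i) = (\<Sum>i\<in>I. C *v f i)"
  for C :: "real^'n^'m"
  by (rule linear_sum) simp

lemma matrix_vector_mult_sum_left: "(\<Sum>i\<in>I. f i) *v x = (\<Sum>i\<in>I. f i *v x)"
  for f :: "'a \<Rightarrow> real^'n^'m"
  by (induction I rule: infinite_finite_induct) (auto simp: matrix_vector_mult_add_rdistrib)

lemma matrix_vector_mult_minus_left: "(- C) *v x = - (C *v x)"
  for C :: "real^'n^'m"
  by (simp add: vec_eq_iff matrix_vector_mult_def sum_negf)

lemma matrix_diff_ldistrib: "C ** (D - E) = C ** D - C ** E"
  for C :: "real^'n^'m" and D E :: "real^'k^'n"
  by (simp add: vec_eq_iff matrix_matrix_mult_def right_diff_distrib sum_subtractf)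

lemma matrix_matrix_mult_nth: "(C ** D) $ i $ j = (\<Sum>m\<in>UNIV. C $ i $ m * D $ m $ j)"
  by (simp add: matrix_matrix_mult_def)

text \<open>The terms with \<open>k + j < n\<close> form complete diagonals, which the convolution
  identity collapses to \<open>y 0\<close>. What remains is a boundary term over windows of bounded
  length. In the application \<open>y m\<close> is the process \<open>m\<close> steps back.\<close>

lemma truncated_inverse_filter:
  fixes P \<Psi> :: "nat \<Rightarrow> real^'n^'n" and y :: "nat \<Rightarrow> real^'n"
  assumes P0: "\<And>j. j > p \<Longrightarrow> P j = 0"
    and inv: "\<And>n. (\<Sum>l\<le>n. \<Psi> l ** P (n - l)) = (if n = 0 then mat 1 else 0)"
    and n: "n > 0"
  shows "(\<Sum>k<n. \<Psi> k *v (\<Sum>j\<le>p. P j *v y (k + j)))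
       = y 0 + (\<Sum>j\<le>p. \<Sum>k\<in>{n - j..<n}. (\<Psi> k ** P j) *v y (k + j))"
proof -
  define f where "f k j = (\<Psi> k ** P j) *v y (k + j)" for k j
  have split: "(\<Sum>k<n. f k j) = (\<Sum>k<n - j. f k j) + (\<Sum>k\<in>{n - j..<n}. f k j)" for j
  proof -
    have "{..<n} = {..<n - j} \<union> {n - j..<n}" by auto
    then show ?thesis by (simp add: sum.union_disjoint ivl_disj_int)
  qed
  have "(\<Sum>j\<le>p. \<Sum>k<n - j. f k j) = (\<Sum>j<n. \<Sum>k<n - j. f k j)"
  proof -
    \<comment> \<open>Terms with \<open>j > p\<close> vanish because \<open>P j = 0\<close>, those
      with \<open>j \<ge> n\<close> because the inner range is empty.\<close>
    have "(\<Sum>j\<le>p. \<Sum>k<n - j. f k j) = (\<Sum>j\<in>{..p} \<union> {..<n}. \<Sum>k<n - j. f k j)"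
      by (rule sum.mono_neutral_left) (auto simp: f_def P0)
    also have "\<dots> = (\<Sum>j<n. \<Sum>k<n - j. f k j)"
      by (rule sum.mono_neutral_right) auto
    finally show ?thesis .
  qed
  also have "\<dots> = (\<Sum>(j, k)\<in>{(j, k). j + k < n}. f k j)"
    by (subst sum.Sigma) (auto intro!: sum.cong)
  also have "\<dots> = (\<Sum>(k, j)\<in>{(k, j). k + j < n}. f k j)"
    by (rule sum.reindex_bij_witness[of _ "\<lambda>(a, b). (b, a)" "\<lambda>(a, b). (b, a)"]) auto
  also have "\<dots> = (\<Sum>m<n. \<Sum>k\<le>m. f k (m - k))"
    by (rule sum.triangle_reindex)
  also have "\<dots> = (\<Sum>m<n. if m = 0 then y 0 else 0)"
  proof (rule sum.cong)
    fix m
    have "(\<Sum>k\<le>m. f k (m - k)) = (\<Sum>k\<le>m. \<Psi> k ** P (m - k)) *v y m"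
      unfolding matrix_vector_mult_sum_left by (rule sum.cong) (auto simp: f_def)
    then show "(\<Sum>k\<le>m. f k (m - k)) = (if m = 0 then y 0 else 0)" by (simp add: inv)
  qed simp
  also have "\<dots> = y 0" using n by (simp add: sum.delta)
  finally have main: "(\<Sum>j\<le>p. \<Sum>k<n - j. f k j) = y 0" .
  have "(\<Sum>k<n. \<Psi> k *v (\<Sum>j\<le>p. P j *v y (k + j))) = (\<Sum>k<n. \<Sum>j\<le>p. f k j)"
    by (simp add: f_def matrix_vector_mult_sum_right matrix_vector_mul_assoc)
  also have "\<dots> = (\<Sum>j\<le>p. \<Sum>k<n. f k j)" by (rule sum.swap)
  also have "\<dots> = y 0 + (\<Sum>j\<le>p. \<Sum>k\<in>{n - j..<n}. f k j)"
    by (simp add: split sum.distrib main)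
  finally show ?thesis by (simp add: f_def)
qed

text \<open>The truncated norm is still subadditive, and being bounded it has an expectation for
  every random vector. It measures convergence in probability.\<close>

lemma min_1_norm_sum_le: "min 1 (norm (\<Sum>i\<in>I. f i)) \<le> (\<Sum>i\<in>I. min 1 (norm (f i)))"
  if "finite I" for f :: "'i \<Rightarrow> 'v::real_normed_vector"
  using that
proof (induction I)
  case (insert i I)
  have "min 1 (norm (f i + sum f I)) \<le> min 1 (norm (f i)) + min 1 (norm (sum f I))"
    using norm_triangle_ineq[of "f i" "sum f I"] norm_ge_zero[of "f i"] norm_ge_zero[of "sum f I"]
    by linarith
  then show ?case using insert by simp
qed simp

section \<open>Conditional independence of sigma-algebras\<close>

definition join_algebra :: "'a measure \<Rightarrow> 'a measure \<Rightarrow> 'a measure" where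
  "join_algebra F G = sigma (space F) (sets F \<union> sets G)"

lemma space_join_algebra [simp]: "space (join_algebra F G) = space F"
  by (simp add: join_algebra_def space_measure_of_conv)

lemma sets_join_algebra:
  "space F = space G \<Longrightarrow> sets (join_algebra F G) = sigma_sets (space F) (sets F \<union> sets G)"
  using sets.space_closed[of F] sets.space_closed[of G]
  by (simp add: join_algebra_def sets_measure_of)

lemma join_algebra_upper:
  assumes "space F = space G"
  shows "sets F \<subseteq> sets (join_algebra F G)" "sets G \<subseteq> sets (join_algebra F G)"
  unfolding sets_join_algebra[OF assms] by auto

lemma join_algebra_least:
  assumes "space F = space G" "space H = space F" "sets F \<subseteq> sets H" "sets G \<subseteq> sets H"
  shows "sets (join_algebra F G) \<subseteq> sets H"
  unfolding sets_join_algebra[OF assms(1)]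
  using assms(3,4) sets.sigma_sets_subset[of "sets F \<union> sets G" H] by (simp add: assms(2))

lemma subalgebra_join_algebra:
  "subalgebra M F \<Longrightarrow> subalgebra M G \<Longrightarrow> subalgebra M (join_algebra F G)"
  unfolding subalgebra_def by (metis join_algebra_least space_join_algebra)

context prob_space
begin

lemma sigma_finite_subalgebraI: "subalgebra M F \<Longrightarrow> sigma_finite_subalgebra M F"
  by (simp add: finite_measure_subalgebra_is_sigma_finite finite_measure_subalgebra_axioms_def
      finite_measure_subalgebra_def finite_measure_axioms)

definition cond_indep_algebra :: "'a measure \<Rightarrow> 'a measure \<Rightarrow> 'a measure \<Rightarrow> bool" where
  "cond_indep_algebra F1 F2 G \<longleftrightarrow> (\<forall>U\<in>sets F1. \<forall>W\<in>sets F2. AE \<omega> in M.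
     real_cond_exp M G (indicator (U \<inter> W)) \<omega> =
     real_cond_exp M G (indicator U) \<omega> * real_cond_exp M G (indicator W) \<omega>)"

lemma cond_indep_algebra_sym: "cond_indep_algebra F1 F2 G \<Longrightarrow> cond_indep_algebra F2 F1 G"
  unfolding cond_indep_algebra_def by (metis (no_types, lifting) Int_commute mult.commute AE_cong)

lemma cond_indep_algebra_mono:
  "cond_indep_algebra F1 F2 G \<Longrightarrow> sets F1' \<subseteq> sets F1 \<Longrightarrow> sets F2' \<subseteq> sets F2 \<Longrightarrow>
   cond_indep_algebra F1' F2' G"
  unfolding cond_indep_algebra_def by blast

lemma integrable_indicator_real [simp]: "U \<in> events \<Longrightarrow> integrable M (indicator U :: 'a \<Rightarrow> real)"
  by (rule integrable_real_indicator) (simp_all add: emeasure_finite less_top[symmetric])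

text \<open>Both sides are countably additive in \<open>V\<close>, so it suffices to treat the
  intersection-stable generator of sets \<open>U \<inter> D\<close>. This is the integrated form of
  the fact that, given \<open>G\<close>, the information in \<open>F1\<close> does not change the
  conditional probability of \<open>W\<close>.\<close>

lemma cond_indep_algebra_absorb:
  assumes sub: "subalgebra M F1" "subalgebra M F2" "subalgebra M G"
    and ci: "cond_indep_algebra F1 F2 G" and W: "W \<in> sets F2"
    and V: "V \<in> sets (join_algebra F1 G)"
  shows "(LINT x:V|M. indicator W x) = (LINT x:V|M. real_cond_exp M G (indicator W) x)"
proof -
  interpret G: sigma_finite_subalgebra M G using sub(3) by (rule sigma_finite_subalgebraI)
  define w where "w = real_cond_exp M G (indicator W)"
  have WM: "W \<in> events" using W sub by (auto simp: subalgebra_def)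
  have intW: "integrable M (indicator W :: 'a \<Rightarrow> real)" using WM by simp
  have intw: "integrable M w" unfolding w_def using G.real_cond_exp_int(1)[OF intW] .
  have wG: "w \<in> borel_measurable G" by (simp add: w_def)
  have spaces: "space F1 = space M" "space G = space M" using sub by (auto simp: subalgebra_def)
  have setint: "set_integrable M D f" if "D \<in> events" "integrable M f" for D and f :: "'a \<Rightarrow> real"
    unfolding set_integrable_def using that by (rule integrable_mult_indicator)
  define Gen where "Gen = {U \<inter> D | U D. U \<in> sets F1 \<and> D \<in> sets G}"
  have GenM: "Gen \<subseteq> events" using sub by (auto simp: Gen_def subalgebra_def)
  have "sets F1 \<union> sets G \<subseteq> Gen"
  proof
    fix X assume "X \<in> sets F1 \<union> sets G"
    then have "X = X \<inter> space M \<and> X \<in> sets F1 \<or> X = space M \<inter> X \<and> X \<in> sets G"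
      using sets.sets_into_space[of X F1] sets.sets_into_space[of X G] spaces by auto
    moreover have "space M \<in> sets F1" "space M \<in> sets G" using spaces sets.top by metis+
    ultimately show "X \<in> Gen" unfolding Gen_def by blast
  qed
  then have VS: "V \<in> sigma_sets (space M) Gen"
    using V sigma_sets_mono'[of "sets F1 \<union> sets G" Gen "space M"] sets_join_algebra[of F1 G] spaces
    by auto
  have genstable: "Int_stable Gen"
  proof (rule Int_stableI)
    fix a b assume "a \<in> Gen" "b \<in> Gen"
    then obtain U D U' D' where "a = U \<inter> D" "b = U' \<inter> D'"
      "U \<in> sets F1" "D \<in> sets G" "U' \<in> sets F1" "D' \<in> sets G" by (auto simp: Gen_def)
    then have "a \<inter> b = (U \<inter> U') \<inter> (D \<inter> D')" "U \<inter> U' \<in> sets F1" "D \<inter> D' \<in> sets G" by auto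
    then show "a \<inter> b \<in> Gen" unfolding Gen_def by blast
  qed
  have genpow: "Gen \<subseteq> Pow (space M)" using GenM sets.sets_into_space by blast
  have inM: "X \<in> events" if "X \<in> sigma_sets (space M) Gen" for X
    using that sets.sigma_sets_subset[OF GenM] by auto
  have "(LINT x:V|M. indicator W x) = (LINT x:V|M. w x)"
    using genstable genpow VS
  proof (induction rule: sigma_sets_induct_disjoint)
    case (basic X)
    then obtain U D where X: "X = U \<inter> D" "U \<in> sets F1" "D \<in> sets G" by (auto simp: Gen_def)
    have UM: "U \<in> events" and DM: "D \<in> events" using X sub by (auto simp: subalgebra_def)
    define u where "u = real_cond_exp M G (indicator U)"
    have "integrable M u" unfolding u_def by (rule G.real_cond_exp_int(1)) (simp add: UM)
    have intDw: "integrable M (\<lambda>x. indicator D x * w x)"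
      using integrable_mult_indicator[OF DM intw] by simp
    have "(\<lambda>x. indicator U x *\<^sub>R (indicator D x * w x)) = (\<lambda>x. (indicator D x * w x) * indicator U x)"
      by (auto simp: mult_ac)
    then have intDwU: "integrable M (\<lambda>x. (indicator D x * w x) * indicator U x)"
      using integrable_mult_indicator[OF UM intDw] by simp
    have mDw: "(\<lambda>x. indicator D x * w x) \<in> borel_measurable G"
      using X(3) wG by measurable
    have "(LINT x:X|M. indicator W x) = (LINT x:D|M. indicator (U \<inter> W) x)"
      unfolding set_lebesgue_integral_def X(1)
      by (rule Bochner_Integration.integral_cong) (auto simp: indicator_def)
    also have "\<dots> = (LINT x:D|M. real_cond_exp M G (indicator (U \<inter> W)) x)"
      by (rule G.real_cond_exp_intA) (use UM WM X(3) in auto)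
    also have "\<dots> = (LINT x:D|M. u x * w x)"
    proof -
      have ae: "AE x in M. real_cond_exp M G (indicator (U \<inter> W)) x = u x * w x"
        using ci X(2) W unfolding cond_indep_algebra_def u_def w_def by blast
      have [measurable]: "u \<in> borel_measurable M" "w \<in> borel_measurable M" "D \<in> events"
        unfolding u_def w_def using DM by auto
      show ?thesis
        by (rule set_lebesgue_integral_cong_AE) (use ae in auto)
    qed
    also have "\<dots> = (LINT x|M. (indicator D x * w x) * u x)"
      unfolding set_lebesgue_integral_def by (rule Bochner_Integration.integral_cong) (auto simp: mult_ac)
    \<comment> \<open>The weight \<open>indicator D x * w x\<close> is \<open>G\<close>-measurable,
      so under the integral \<open>u\<close> may be replaced by the indicator of
      \<open>U\<close>.\<close>
    also have "\<dots> = (LINT x|M. (indicator D x * w x) * indicator U x)"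
      unfolding u_def by (rule G.real_cond_exp_intg(2)[OF intDwU mDw]) (use UM in simp)
    also have "\<dots> = (LINT x:X|M. w x)"
      unfolding set_lebesgue_integral_def X(1)
      by (rule Bochner_Integration.integral_cong) (auto simp: indicator_def)
    finally show ?case .
  next
    case empty
    then show ?case by (simp add: set_lebesgue_integral_def)
  next
    case (compl X)
    have diff: "(LINT x:space M - X|M. f x) = (LINT x|M. f x) - (LINT x:X|M. f x)"
      if "integrable M f" for f :: "'a \<Rightarrow> real"
    proof -
      have "(LINT x:space M - X|M. f x) = (LINT x|M. f x - indicator X x *\<^sub>R f x)"
        unfolding set_lebesgue_integral_def
        by (rule Bochner_Integration.integral_cong) (auto simp: indicator_def)
      also have "\<dots> = (LINT x|M. f x) - (LINT x:X|M. f x)"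
        unfolding set_lebesgue_integral_def
        by (rule Bochner_Integration.integral_diff)
          (use that integrable_mult_indicator[OF inM[OF compl(1)] that] in auto)
      finally show ?thesis .
    qed
    have "(LINT x|M. w x) = (LINT x|M. indicator W x)"
      unfolding w_def by (rule G.real_cond_exp_int(2)[OF intW])
    then show ?case using diff[OF intW] diff[OF intw] compl by simp
  next
    case (union X)
    have XM: "X i \<in> events" for i using union(2) inM by auto
    have UM: "(\<Union>i. X i) \<in> events" using XM by auto
    have disj: "X i \<inter> X j = {}" if "i \<noteq> j" for i j
      using union(1) that by (auto simp: disjoint_family_on_def)
    show ?case
      using lebesgue_integral_countable_add[OF XM disj setint[OF UM intW]]
        lebesgue_integral_countable_add[OF XM disj setint[OF UM intw]] union(3) by simp
  qed
  then show ?thesis by (simp add: w_def)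
qed

text \<open>Since \<open>G'\<close> lies between \<open>G\<close> and the join, the conditional
  probability \<open>w\<close> of \<open>W\<close> given \<open>G\<close> is also a version given
  \<open>G'\<close>. A set \<open>D\<close> of \<open>G'\<close> meets \<open>V\<close> in a set of
  the join, where \<open>indicator W\<close> may be replaced by \<open>w\<close>; then
  \<open>w\<close> is pulled out of the expectation given \<open>G'\<close>. With
  \<open>G' = G\<close> the lemma enlarges one side only.\<close>

lemma cond_indep_algebra_extend:
  assumes sub: "subalgebra M F1" "subalgebra M F2" "subalgebra M G" "subalgebra M G'"
    and ci: "cond_indep_algebra F1 F2 G"
    and GG': "sets G \<subseteq> sets G'" "sets G' \<subseteq> sets (join_algebra F1 G)"
  shows "cond_indep_algebra (join_algebra F1 G) F2 G'"
  unfolding cond_indep_algebra_def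
proof (intro ballI)
  fix V W assume V: "V \<in> sets (join_algebra F1 G)" and W: "W \<in> sets F2"
  interpret G: sigma_finite_subalgebra M G using sub(3) by (rule sigma_finite_subalgebraI)
  interpret G': sigma_finite_subalgebra M G' using sub(4) by (rule sigma_finite_subalgebraI)
  define w where "w = real_cond_exp M G (indicator W)"
  note absorb = cond_indep_algebra_absorb[OF sub(1-3) ci W, folded w_def]
  have WM: "W \<in> events" using W sub by (auto simp: subalgebra_def)
  have VM: "V \<in> events" using V subalgebra_join_algebra[OF sub(1,3)] by (auto simp: subalgebra_def)
  have intw: "integrable M w"
    unfolding w_def by (rule G.real_cond_exp_int(1)) (simp add: WM)
  have sp: "space G = space G'" using sub by (simp add: subalgebra_def)
  have wG': "w \<in> borel_measurable G'"
    unfolding w_def by (rule measurable_from_subalg[of G' G]) (auto simp: subalgebra_def sp GG')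
  have W': "AE x in M. real_cond_exp M G' (indicator W) x = w x"
    by (rule G'.real_cond_exp_charact) (use absorb GG'(2) intw wG' WM in auto)
  let ?v = "real_cond_exp M G' (indicator V)"
  have intwV: "integrable M (\<lambda>x. w x * indicator V x)"
    using integrable_mult_indicator[OF VM intw] by (simp add: mult.commute)
  have "AE x in M. real_cond_exp M G' (indicator (V \<inter> W)) x = w x * ?v x"
  proof (rule G'.real_cond_exp_charact)
    fix D assume D: "D \<in> sets G'"
    have DM: "D \<in> events" using D sub by (auto simp: subalgebra_def)
    have DV: "D \<inter> V \<in> sets (join_algebra F1 G)" using D V GG' by auto
    have [measurable]: "D \<in> sets G'" by (rule D)
    note wG' [measurable]
    have mDw: "(\<lambda>x. indicator D x * w x) \<in> borel_measurable G'" by measurable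
    have "(\<lambda>x. indicator D x *\<^sub>R (w x * indicator V x)) = (\<lambda>x. (indicator D x * w x) * indicator V x)"
      by auto
    then have intDwV: "integrable M (\<lambda>x. (indicator D x * w x) * indicator V x)"
      using integrable_mult_indicator[OF DM intwV] by simp
    have "(LINT x:D|M. indicator (V \<inter> W) x) = (LINT x:D \<inter> V|M. (indicator W x :: real))"
      unfolding set_lebesgue_integral_def
      by (rule Bochner_Integration.integral_cong) (auto simp: indicator_def)
    also have "\<dots> = (LINT x:D \<inter> V|M. w x)" by (rule absorb[OF DV])
    also have "\<dots> = (LINT x|M. (indicator D x * w x) * indicator V x)"
      unfolding set_lebesgue_integral_def
      by (rule Bochner_Integration.integral_cong) (auto simp: indicator_def)
    also have "\<dots> = (LINT x|M. (indicator D x * w x) * ?v x)"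
      by (rule G'.real_cond_exp_intg(2)[OF intDwV mDw, symmetric]) (use VM in simp)
    also have "\<dots> = (LINT x:D|M. w x * ?v x)"
      unfolding set_lebesgue_integral_def by (rule Bochner_Integration.integral_cong) (auto simp: mult_ac)
    finally show "(LINT x:D|M. indicator (V \<inter> W) x) = (LINT x:D|M. w x * ?v x)" .
  next
    show "integrable M (\<lambda>x. w x * ?v x)"
      by (rule G'.real_cond_exp_intg(1)[OF intwV wG']) (use VM in simp)
    show "(\<lambda>x. w x * ?v x) \<in> borel_measurable G'" using wG' by measurable
  qed (use VM WM in auto)
  with W' show "AE x in M. real_cond_exp M G' (indicator (V \<inter> W)) x = ?v x * real_cond_exp M G' (indicator W) x"
    by eventually_elim simp
qed

text \<open>Given a trivial algebra, conditional probabilities are constants. This starts the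
  induction over the conditioning vertices.\<close>

lemma cond_indep_algebra_trivial:
  assumes sub: "subalgebra M F1" "subalgebra M F2" "subalgebra M G"
    and triv: "sets G \<subseteq> {{}, space M}"
    and indep: "\<And>U W. U \<in> sets F1 \<Longrightarrow> W \<in> sets F2 \<Longrightarrow> prob (U \<inter> W) = prob U * prob W"
  shows "cond_indep_algebra F1 F2 G"
proof -
  interpret G: sigma_finite_subalgebra M G using sub(3) by (rule sigma_finite_subalgebraI)
  have const: "AE x in M. real_cond_exp M G (indicator U) x = prob U" if "U \<in> events" for U
  proof (rule G.real_cond_exp_charact)
    fix D assume "D \<in> sets G"
    then consider "D = {}" | "D = space M" using triv by auto
    then show "(LINT x:D|M. indicator U x) = (LINT x:D|M. prob U)"
    proof cases
      case 2
      have "(LINT x:D|M. indicator U x) = (LINT x|M. (indicator U x :: real))"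
        unfolding set_lebesgue_integral_def 2
        by (rule Bochner_Integration.integral_cong) auto
      also have "\<dots> = prob U" using that sets.sets_into_space by (simp add: Int_absorb2)
      also have "\<dots> = (LINT x:D|M. prob U)"
      proof -
        have "(LINT x:D|M. prob U) = (LINT x|M. prob U)"
          unfolding set_lebesgue_integral_def 2
          by (rule Bochner_Integration.integral_cong) auto
        then show ?thesis by (simp add: prob_space)
      qed
      finally show ?thesis .
    qed (simp add: set_lebesgue_integral_def)
  qed (use that in auto)
  show ?thesis unfolding cond_indep_algebra_def
  proof (intro ballI)
    fix U W assume UW: "U \<in> sets F1" "W \<in> sets F2"
    then have M: "U \<in> events" "W \<in> events" using sub by (auto simp: subalgebra_def)
    show "AE x in M. real_cond_exp M G (indicator (U \<inter> W)) x =
        real_cond_exp M G (indicator U) x * real_cond_exp M G (indicator W) x"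
      using const[OF M(1)] const[OF M(2)] const[OF sets.Int[OF M]]
      by eventually_elim (simp add: indep[OF UW])
  qed
qed

text \<open>The structural equations and the moving average limit hold only almost surely. Admitting
  events that differ from a set of \<open>F\<close> by a null set turns such equalities into
  measurability and preserves independence.\<close>

definition null_completion :: "'a measure \<Rightarrow> 'a measure" where
  "null_completion F = sigma (space M) {U \<in> events. \<exists>U'\<in>sets F. AE x in M. x \<in> U \<longleftrightarrow> x \<in> U'}"

lemma space_null_completion [simp]: "space (null_completion F) = space M"
  by (simp add: null_completion_def space_measure_of_conv)

lemma sets_null_completion:
  assumes "subalgebra M F"
  shows "sets (null_completion F) = {U \<in> events. \<exists>U'\<in>sets F. AE x in M. x \<in> U \<longleftrightarrow> x \<in> U'}"
    (is "_ = ?S")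
proof -
  have sp: "space F = space M" using assms by (simp add: subalgebra_def)
  have sub: "?S \<subseteq> Pow (space M)" using sets.sets_into_space by blast
  have "sigma_algebra (space M) ?S" unfolding sigma_algebra_iff2
  proof (intro conjI ballI allI impI)
    show "{} \<in> ?S" by auto
  next
    fix U assume "U \<in> ?S"
    then obtain U' where U: "U \<in> events" "U' \<in> sets F" "AE x in M. x \<in> U \<longleftrightarrow> x \<in> U'" by auto
    have "AE x in M. x \<in> space M - U \<longleftrightarrow> x \<in> space F - U'"
      using U(3) by eventually_elim (auto simp: sp)
    then show "space M - U \<in> ?S" using U by blast
  next
    fix X :: "nat \<Rightarrow> 'a set" assume X: "range X \<subseteq> ?S"
    then have "\<forall>n. \<exists>U'. U' \<in> sets F \<and> (AE x in M. x \<in> X n \<longleftrightarrow> x \<in> U')" by blast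
    then obtain Y where Y: "\<And>n. Y n \<in> sets F" "\<And>n. AE x in M. x \<in> X n \<longleftrightarrow> x \<in> Y n" by metis
    have "AE x in M. \<forall>n. x \<in> X n \<longleftrightarrow> x \<in> Y n" using Y(2) by (simp add: AE_all_countable)
    then have "AE x in M. x \<in> (\<Union>n. X n) \<longleftrightarrow> x \<in> (\<Union>n. Y n)" by eventually_elim auto
    moreover have "(\<Union>n. X n) \<in> events" "(\<Union>n. Y n) \<in> sets F" using X Y(1) by auto
    ultimately show "(\<Union>n. X n) \<in> ?S" by blast
  qed (rule sub)
  then show ?thesis
    unfolding null_completion_def by (simp add: sets_measure_of[OF sub] sigma_algebra.sigma_sets_eq)
qed

lemma subalgebra_null_completion: "subalgebra M F \<Longrightarrow> subalgebra M (null_completion F)"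
  by (auto simp: subalgebra_def sets_null_completion)

lemma sets_subset_null_completion: "subalgebra M F \<Longrightarrow> sets F \<subseteq> sets (null_completion F)"
  by (auto simp: sets_null_completion subalgebra_def)

lemma null_sets_null_completion:
  assumes "subalgebra M F" "N \<in> events" "AE x in M. x \<notin> N"
  shows "N \<in> sets (null_completion F)"
  using assms by (auto simp: sets_null_completion intro!: bexI[of _ "{}"])

lemma prob_Int_null_completion:
  assumes F: "subalgebra M F1" "subalgebra M F2"
    and indep: "\<And>U W. U \<in> sets F1 \<Longrightarrow> W \<in> sets F2 \<Longrightarrow> prob (U \<inter> W) = prob U * prob W"
    and U: "U \<in> sets (null_completion F1)" and W: "W \<in> sets (null_completion F2)"
  shows "prob (U \<inter> W) = prob U * prob W"
proof -
  obtain U' where U': "U \<in> events" "U' \<in> sets F1" "AE x in M. x \<in> U \<longleftrightarrow> x \<in> U'"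
    using U F by (auto simp: sets_null_completion)
  obtain W' where W': "W \<in> events" "W' \<in> sets F2" "AE x in M. x \<in> W \<longleftrightarrow> x \<in> W'"
    using W F by (auto simp: sets_null_completion)
  have M: "U' \<in> events" "W' \<in> events" using U' W' F by (auto simp: subalgebra_def)
  have "prob U = prob U'" by (rule measure_eq_AE) (use U' M in auto)
  moreover have "prob W = prob W'" by (rule measure_eq_AE) (use W' M in auto)
  moreover have "AE x in M. x \<in> U \<inter> W \<longleftrightarrow> x \<in> U' \<inter> W'"
    using U'(3) W'(3) by eventually_elim auto
  then have "prob (U \<inter> W) = prob (U' \<inter> W')"
    by (rule measure_eq_AE) (use U' W' M in auto)
  ultimately show ?thesis using indep[OF U'(2) W'(2)] by simp
qed

text \<open>Preimages under \<open>f\<close> and \<open>g\<close> differ by null events, and these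
  belong to \<open>H\<close>.\<close>

lemma measurable_AE_cong:
  assumes H: "subalgebra M H"
    and null: "\<And>N. N \<in> events \<Longrightarrow> AE x in M. x \<notin> N \<Longrightarrow> N \<in> sets H"
    and f: "f \<in> measurable M K" and g: "g \<in> measurable H K"
    and eq: "AE x in M. f x = g x"
  shows "f \<in> measurable H K"
proof (rule measurableI)
  have sp: "space H = space M" using H by (simp add: subalgebra_def)
  show "f x \<in> space K" if "x \<in> space H" for x using f that sp by (auto dest: measurable_space)
  fix U assume U: "U \<in> sets K"
  let ?f = "f -` U \<inter> space M" and ?g = "g -` U \<inter> space H"
  have fM: "?f \<in> events" and gH: "?g \<in> sets H" using f g U by (auto dest: measurable_sets)
  have gM: "?g \<in> events" using gH H by (auto simp: subalgebra_def)
  have "AE x in M. x \<notin> ?f - ?g" using eq by eventually_elim (auto simp: sp)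
  then have 1: "?f - ?g \<in> sets H" using fM gM by (intro null) auto
  have "AE x in M. x \<notin> ?g - ?f" using eq by eventually_elim (auto simp: sp)
  then have 2: "?g - ?f \<in> sets H" using fM gM by (intro null) auto
  have "f -` U \<inter> space H = (?g - (?g - ?f)) \<union> (?f - ?g)" using sp by auto
  then show "f -` U \<inter> space H \<in> sets H" using 1 2 gH by simp
qed

text \<open>Pulled back from the product space by the whole tuple, so that for \<open>endo\<close>
  it is literally the conditioning algebra in \<open>cond_indep_var\<close>.\<close>

definition generated_algebra :: "('v \<Rightarrow> 'a \<Rightarrow> real) \<Rightarrow> 'v set \<Rightarrow> 'a measure" where
  "generated_algebra X N = vimage_algebra (space M) (\<lambda>\<omega>. \<lambda>v\<in>N. X v \<omega>) (\<Pi>\<^sub>M v\<in>N. borel)"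

lemma space_generated_algebra [simp]: "space (generated_algebra X N) = space M"
  by (simp add: generated_algebra_def)

lemma generated_algebra_least:
  assumes "space H = space M" "\<And>v. v \<in> N \<Longrightarrow> X v \<in> borel_measurable H"
  shows "sets (generated_algebra X N) \<subseteq> sets H"
  unfolding generated_algebra_def
  by (rule sets_image_in_sets) (use assms in \<open>auto intro: measurable_restrict\<close>)

lemma subalgebra_generated_algebra:
  "(\<And>v. v \<in> N \<Longrightarrow> X v \<in> borel_measurable M) \<Longrightarrow> subalgebra M (generated_algebra X N)"
  by (simp add: subalgebra_def generated_algebra_least)

lemma measurable_generated_algebra:
  assumes "v \<in> N"
  shows "X v \<in> borel_measurable (generated_algebra X N)"
proof -
  have "(\<lambda>\<omega>. \<lambda>v\<in>N. X v \<omega>) \<in> measurable (generated_algebra X N) (\<Pi>\<^sub>M v\<in>N. borel)"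
    unfolding generated_algebra_def by (rule measurable_vimage_algebra1) (auto simp: space_PiM)
  from measurable_compose[OF this measurable_component_singleton[OF assms]]
  show ?thesis using assms by simp
qed

lemma generated_algebra_mono: "N \<subseteq> N' \<Longrightarrow> sets (generated_algebra X N) \<subseteq> sets (generated_algebra X N')"
  by (rule generated_algebra_least) (auto intro: measurable_generated_algebra)

lemma sets_generated_algebra_empty: "sets (generated_algebra X {}) \<subseteq> {{}, space M}"
  unfolding generated_algebra_def
  by (subst sets_vimage_algebra2) (auto simp: space_PiM sets_PiM_empty)

lemma prob_Int_generated_algebra:
  assumes "indep_vars (\<lambda>_. borel) X UNIV" "N \<inter> N' = {}"
    and "U \<in> sets (generated_algebra X N)" "W \<in> sets (generated_algebra X N')"
  shows "prob (U \<inter> W) = prob U * prob W"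
proof -
  have "indep_var (PiM N (\<lambda>_. borel)) (\<lambda>\<omega>. \<lambda>v\<in>N. X v \<omega>) (PiM N' (\<lambda>_. borel)) (\<lambda>\<omega>. \<lambda>v\<in>N'. X v \<omega>)"
    using indep_var_restrict[OF assms(1,2)] by simp
  then have "indep_set (sets (generated_algebra X N)) (sets (generated_algebra X N'))"
    by (simp add: indep_var_eq generated_algebra_def sets_vimage_algebra)
  then show ?thesis using assms(3,4) by (rule indep_setD)
qed

end

section \<open>Process values as functions of ancestral innovations\<close>

context varma
begin

section \<open>Scalar variables and coefficients of the structural equation\<close>

definition innov :: "int \<times> 'd \<Rightarrow> 'w \<Rightarrow> real" where
  "innov u \<omega> = \<epsilon> (fst u) \<omega> $ snd u"

definition endo :: "int \<times> 'd \<Rightarrow> 'w \<Rightarrow> real" where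
  "endo v \<omega> = S (fst v) \<omega> $ snd v"

definition noise :: "int \<Rightarrow> 'w \<Rightarrow> real^'d" where
  "noise t \<omega> = \<epsilon> t \<omega> + (\<Sum>l=1..q. B l *v \<epsilon> (t - int l) \<omega>)"

abbreviation innov_parents :: "int \<times> 'd \<Rightarrow> (int \<times> 'd) set" where
  "innov_parents v \<equiv> {u. (Innov u, Endo v) \<in> full_time_edges p q A B}"

abbreviation "graph \<equiv> varma_admg p q A B"

text \<open>The coefficients of the polynomial \<open>I - A 0 - A 1 z - ... - A p z ^ p\<close>,
  extended by zero so that convolutions may run over all indices.\<close>

definition ar_coeff :: "nat \<Rightarrow> real^'d^'d" where
  "ar_coeff k = (if k = 0 then mat 1 - A 0 else if k \<le> p then - A k else 0)"

lemma dir_graph_iff: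
  "(w, v) \<in> dir graph \<longleftrightarrow>
     (\<exists>k\<le>p. fst w = fst v - int k \<and> A k $ snd v $ snd w \<noteq> 0)"
  by (cases v; cases w) (auto simp: varma_admg_def full_time_edges_def)

lemma dir_graph_time: "(w, v) \<in> dir graph \<Longrightarrow> fst w \<le> fst v"
  by (auto simp: dir_graph_iff)

lemma dir_graph_rtrancl_time: "(w, v) \<in> (dir graph)\<^sup>* \<Longrightarrow> fst w \<le> fst v"
  by (induction rule: rtrancl_induct) (auto dest: dir_graph_time)

lemma innov_parents_iff:
  "(Innov u, Endo v) \<in> full_time_edges p q A B \<longleftrightarrow>
     u = v \<or> (\<exists>l. 1 \<le> l \<and> l \<le> q \<and> fst u = fst v - int l \<and> B l $ snd v $ snd u \<noteq> 0)"
  by (cases v; cases u) (auto simp: full_time_edges_def)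

lemma innov_measurable [measurable]: "innov u \<in> borel_measurable M"
proof -
  have [measurable]: "\<epsilon> t \<in> borel_measurable M" for t
    using innov_indep by (auto simp: indep_vars_def)
  have "(\<lambda>\<omega>. \<epsilon> (fst u) \<omega> \<bullet> axis (snd u) 1) \<in> borel_measurable M" by measurable
  then show ?thesis by (simp add: innov_def[abs_def] cart_eq_inner_axis)
qed

lemma S_borel [measurable]: "S t \<in> borel_measurable M"
  using S_measurable by simp

lemma endo_measurable [measurable]: "endo v \<in> borel_measurable M"
proof -
  have "(\<lambda>\<omega>. S (fst v) \<omega> \<bullet> axis (snd v) 1) \<in> borel_measurable M" by measurable
  then show ?thesis by (simp add: endo_def[abs_def] cart_eq_inner_axis)
qed

lemma noise_nth: "noise (fst v) \<omega> $ snd v =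
    innov v \<omega> + (\<Sum>l=1..q. \<Sum>j\<in>UNIV. B l $ snd v $ j * innov (fst v - int l, j) \<omega>)"
  by (simp add: noise_def innov_def matrix_vector_mult_def sum_component)

text \<open>Terms with a vanishing entry of \<open>B l\<close> are constantly zero; the others
  belong to innovations that are parents of \<open>v\<close>.\<close>

lemma noise_measurable:
  assumes "\<And>u. u \<in> innov_parents v \<Longrightarrow> innov u \<in> borel_measurable H"
  shows "(\<lambda>\<omega>. noise (fst v) \<omega> $ snd v) \<in> borel_measurable H"
proof -
  have "(\<lambda>\<omega>. B l $ snd v $ j * innov (fst v - int l, j) \<omega>) \<in> borel_measurable H"
    if "l \<in> {1..q}" for l j
  proof (cases "B l $ snd v $ j = 0")
    case False
    then have "innov (fst v - int l, j) \<in> borel_measurable H"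
      using that by (intro assms) (auto simp: innov_parents_iff)
    then show ?thesis by measurable
  qed simp
  moreover have "innov v \<in> borel_measurable H" by (intro assms) (simp add: innov_parents_iff)
  ultimately show ?thesis
    unfolding noise_nth by (intro borel_measurable_add borel_measurable_sum)
qed

text \<open>A finite index set splits into time slices. Independence over time factorizes the
  probability over the slices, and independence of the components factorizes each slice.\<close>

lemma indep_vars_innov: "indep_vars (\<lambda>_. borel) innov UNIV"
  unfolding indep_vars_def2
proof (intro conjI ballI indep_setsI)
  show "random_variable borel (innov u)" for u by measurable
  then show "{innov u -` X \<inter> space M |X. X \<in> sets borel} \<subseteq> events" for u
    by (auto dest: measurable_sets)
  fix E and J :: "(int \<times> 'd) set"
  assume J: "J \<noteq> {}" "finite J" and E: "\<forall>u\<in>J. E u \<in> {innov u -` X \<inter> space M |X. X \<in> sets borel}"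
  from E have "\<forall>u. \<exists>X. u \<in> J \<longrightarrow> X \<in> sets borel \<and> E u = innov u -` X \<inter> space M" by blast
  then obtain X where X: "\<And>u. u \<in> J \<Longrightarrow> X u \<in> sets borel"
    "\<And>u. u \<in> J \<Longrightarrow> E u = innov u -` X u \<inter> space M" by metis
  define T where "T = fst ` J"
  define I where "I t = {i. (t, i) \<in> J}" for t
  have JS: "J = Sigma T I" by (force simp: T_def I_def)
  have fin: "finite T" "finite (I t)" and Tne: "T \<noteq> {}" for t using J by (auto simp: T_def)
  have Ine: "I t \<noteq> {}" if "t \<in> T" for t using that by (auto simp: T_def I_def)
  \<comment> \<open>The event of one slice becomes a condition on the vector
    \<open>\<epsilon> t\<close>, to which the independence over time applies.\<close>
  define Y where "Y t = {x :: real^'d. \<forall>i\<in>I t. x $ i \<in> X (t, i)}" for t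
  have Yb: "Y t \<in> sets borel" if "t \<in> T" for t
  proof -
    have "{x :: real^'d. x $ i \<in> X (t, i)} \<in> sets borel" if "i \<in> I t" for i
    proof -
      have "(\<lambda>x :: real^'d. x \<bullet> axis i 1) \<in> borel_measurable borel" by measurable
      then have "(\<lambda>x :: real^'d. x $ i) \<in> borel_measurable borel" by (simp add: cart_eq_inner_axis)
      from measurable_sets[OF this X(1)[of "(t, i)"]] that
      show ?thesis by (simp add: vimage_def I_def)
    qed
    then have "(\<Inter>i\<in>I t. {x :: real^'d. x $ i \<in> X (t, i)}) \<in> sets borel"
      using fin Ine[OF that] by (intro sets.finite_INT) auto
    moreover have "Y t = (\<Inter>i\<in>I t. {x :: real^'d. x $ i \<in> X (t, i)})" by (auto simp: Y_def)
    ultimately show ?thesis by simp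
  qed
  have Et: "\<epsilon> t -` Y t \<inter> space M = (\<Inter>i\<in>I t. E (t, i))" if "t \<in> T" for t
    using X(2) Ine[OF that] by (auto simp: Y_def I_def innov_def)
  have Ei: "E (t, i) = (\<lambda>\<omega>. \<epsilon> t \<omega> $ i) -` X (t, i) \<inter> space M" if "(t, i) \<in> J" for t i
    using X(2)[OF that] by (simp add: innov_def[abs_def])
  have "prob (\<Inter>u\<in>J. E u) = prob (\<Inter>t\<in>T. \<epsilon> t -` Y t \<inter> space M)"
    by (rule arg_cong[where f = prob]) (auto simp: JS Et)
  also have "\<dots> = (\<Prod>t\<in>T. prob (\<epsilon> t -` Y t \<inter> space M))"
    by (rule indep_varsD[OF innov_indep]) (use Tne fin Yb in auto)
  also have "\<dots> = (\<Prod>t\<in>T. \<Prod>i\<in>I t. prob (E (t, i)))"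
  proof (rule prod.cong)
    fix t assume t: "t \<in> T"
    have "prob (\<epsilon> t -` Y t \<inter> space M) = prob (\<Inter>i\<in>I t. (\<lambda>\<omega>. \<epsilon> t \<omega> $ i) -` X (t, i) \<inter> space M)"
      unfolding Et[OF t] by (rule arg_cong[where f = prob]) (use Ei in \<open>auto simp: I_def\<close>)
    also have "\<dots> = (\<Prod>i\<in>I t. prob ((\<lambda>\<omega>. \<epsilon> t \<omega> $ i) -` X (t, i) \<inter> space M))"
      by (rule indep_varsD[OF innov_components]) (use Ine[OF t] fin X(1) in \<open>auto simp: I_def\<close>)
    also have "\<dots> = (\<Prod>i\<in>I t. prob (E (t, i)))"
      by (rule prod.cong) (use Ei in \<open>auto simp: I_def\<close>)
    finally show "prob (\<epsilon> t -` Y t \<inter> space M) = (\<Prod>i\<in>I t. prob (E (t, i)))" .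
  qed simp
  also have "\<dots> = (\<Prod>u\<in>J. prob (E u))"
    using fin by (simp add: JS prod.Sigma)
  finally show "prob (\<Inter>u\<in>J. E u) = (\<Prod>u\<in>J. prob (E u))" .
qed

section \<open>Stationarity and the moving average representation\<close>

lemma distr_S: "distr M borel (S t) = distr M borel (S 0)"
proof -
  have meas: "(\<lambda>\<omega> s. S (s + h) \<omega>) \<in> measurable M (\<Pi>\<^sub>M s\<in>UNIV. borel)" for h
    by (rule measurable_PiM_single') (auto simp: space_PiM)
  have proj: "(\<lambda>x. x 0) \<in> measurable (\<Pi>\<^sub>M s\<in>UNIV. borel) (borel :: (real^'d) measure)"
    by (rule measurable_component_singleton) simp
  have "distr M borel (S h) = distr (distr M (\<Pi>\<^sub>M s\<in>UNIV. borel) (\<lambda>\<omega> s. S (s + h) \<omega>)) borel (\<lambda>x. x 0)"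
    for h using meas[of h] proj by (subst distr_distr) (auto simp: comp_def)
  moreover have "distr M (\<Pi>\<^sub>M s\<in>UNIV. borel) (\<lambda>\<omega> s. S (s + t) \<omega>) =
      distr M (\<Pi>\<^sub>M s\<in>UNIV. borel) (\<lambda>\<omega> s. S (s + 0) \<omega>)"
    using S_stationary unfolding stationary_def by (metis add_0_right)
  ultimately show ?thesis by metis
qed

lemma integral_S_shift:
  assumes "g \<in> borel_measurable borel"
  shows "(LINT \<omega>|M. g (S t \<omega>)) = (LINT \<omega>|M. (g (S 0 \<omega>) :: real))"
  using integral_distr[of "S t" M borel g] integral_distr[of "S 0" M borel g] assms distr_S[of t]
  by simp

lemma ar_equation: "AE \<omega> in M. (\<Sum>j\<le>p. ar_coeff j *v S (t - int j) \<omega>) = noise t \<omega>"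
  using S_equation[of t]
proof eventually_elim
  case (elim \<omega>)
  have "(\<Sum>j\<le>p. ar_coeff j *v S (t - int j) \<omega>)
      = (\<Sum>j\<le>p. (if j = 0 then S t \<omega> else 0) - A j *v S (t - int j) \<omega>)"
    by (rule sum.cong) (auto simp: ar_coeff_def matrix_vector_mult_diff_rdistrib
        matrix_vector_mult_minus_left)
  also have "\<dots> = S t \<omega> - (\<Sum>j=0..p. A j *v S (t - int j) \<omega>)"
    by (simp add: sum_subtractf sum.delta atMost_atLeast0)
  also have "\<dots> = noise t \<omega>" using elim by (simp add: noise_def algebra_simps)
  finally show ?case .
qed

lemma ma_coeff_exists:
  obtains \<Psi> :: "nat \<Rightarrow> real^'d^'d"
  where "\<And>i j. (\<lambda>k. \<Psi> k $ i $ j) \<longlonglongrightarrow> 0"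
    and "\<And>n. (\<Sum>l\<le>n. \<Psi> l ** ar_coeff (n - l)) = (if n = 0 then mat 1 else 0)"
proof (rule matrix_power_series_inverse[of p ar_coeff])
  show "det (\<chi> i j. \<Sum>k\<le>p. complex_of_real (ar_coeff k $ i $ j) * z ^ k) \<noteq> 0"
    if "cmod z \<le> 1" for z
  proof -
    have "(\<chi> i j. \<Sum>k\<le>p. complex_of_real (ar_coeff k $ i $ j) * z ^ k) =
      (\<chi> i j. \<Sum>k\<le>p. complex_of_real ((if k = 0 then mat 1 - A 0 else - A k) $ i $ j) * z ^ k)"
      by (auto simp: vec_eq_iff ar_coeff_def intro!: sum.cong)
    then show ?thesis using det_stable_nonzero[OF acyclic_full stable that] by simp
  qed
qed (auto simp: ar_coeff_def)

text \<open>The convolution identity expresses \<open>\<Psi> n\<close> by the unit matrix,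
  \<open>\<Psi> n ** A 0\<close> and products of earlier coefficients with \<open>ar_coeff\<close>.
  A nonzero entry needs a nonzero summand, whose last factor gives a directed edge leaving
  \<open>j\<close>. As \<open>\<Psi> n\<close> itself recurs in the expression, an inner induction
  passes from \<open>j\<close> to its instantaneous children.\<close>

lemma ma_coeff_nonzero_imp_path:
  assumes inv: "\<And>n. (\<Sum>l\<le>n. \<Psi> l ** ar_coeff (n - l)) = (if n = 0 then mat 1 else 0)"
    and "\<Psi> n $ i $ j \<noteq> 0"
  shows "((t - int n, j), (t, i)) \<in> (dir graph)\<^sup>*"
  using assms(2)
proof (induction n arbitrary: j rule: less_induct)
  case (less n)
  show ?case
    using wf_instantaneous(2)[OF acyclic_full] less.prems
  proof (induction j)
    case (less j)
    note IH = \<open>\<And>m l. m < n \<Longrightarrow> \<Psi> m $ i $ l \<noteq> 0 \<Longrightarrow> ((t - int m, l), (t, i)) \<in> (dir graph)\<^sup>*\<close>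
    have "(\<Sum>l\<le>n. \<Psi> l ** ar_coeff (n - l)) = \<Psi> n ** ar_coeff 0 + (\<Sum>l<n. \<Psi> l ** ar_coeff (n - l))"
      by (simp add: lessThan_Suc_atMost[symmetric])
    moreover have "ar_coeff 0 = mat 1 - A 0" by (simp add: ar_coeff_def)
    ultimately have "\<Psi> n ** (mat 1 - A 0) + (\<Sum>l<n. \<Psi> l ** ar_coeff (n - l)) = (if n = 0 then mat 1 else 0)"
      using inv[of n] by simp
    then have eq: "\<Psi> n = (if n = 0 then mat 1 else 0) + \<Psi> n ** A 0 - (\<Sum>l<n. \<Psi> l ** ar_coeff (n - l))"
      by (simp add: matrix_diff_ldistrib algebra_simps)
    have nth: "\<Psi> n $ i $ j = (if n = 0 then mat 1 else 0) $ i $ j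
        + (\<Sum>m\<in>UNIV. \<Psi> n $ i $ m * A 0 $ m $ j)
        - (\<Sum>l<n. \<Sum>m\<in>UNIV. \<Psi> l $ i $ m * ar_coeff (n - l) $ m $ j)"
      using arg_cong[OF eq, of "\<lambda>X. X $ i $ j"] by (simp add: matrix_matrix_mult_nth)
    have "(if n = 0 then mat 1 else (0 :: real^'d^'d)) $ i $ j \<noteq> 0
        \<or> (\<exists>m. \<Psi> n $ i $ m * A 0 $ m $ j \<noteq> 0)
        \<or> (\<exists>l<n. \<exists>m. \<Psi> l $ i $ m * ar_coeff (n - l) $ m $ j \<noteq> 0)"
    proof (rule ccontr)
      assume neg: "\<not> ?thesis"
      have "(\<Sum>m\<in>UNIV. \<Psi> n $ i $ m * A 0 $ m $ j) = 0"
        using neg by (intro sum.neutral) blast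
      moreover have "(\<Sum>l<n. \<Sum>m\<in>UNIV. \<Psi> l $ i $ m * ar_coeff (n - l) $ m $ j) = 0"
        using neg by (intro sum.neutral ballI) (blast dest: lessThan_iff[THEN iffD1])
      moreover have "(if n = 0 then mat 1 else (0 :: real^'d^'d)) $ i $ j = 0" using neg by blast
      ultimately have "\<Psi> n $ i $ j = 0" using nth by linarith
      then show False using less.prems by simp
    qed
    then consider "n = 0" "i = j"
      | m where "\<Psi> n $ i $ m \<noteq> 0" "A 0 $ m $ j \<noteq> 0"
      | l m where "l < n" "\<Psi> l $ i $ m \<noteq> 0" "ar_coeff (n - l) $ m $ j \<noteq> 0"
      by (fastforce simp: mat_def split: if_splits)
    then show ?case
    proof cases
      case 1
      then show ?thesis by simp
    next
      case 2
      then have "((t - int n, m), (t, i)) \<in> (dir graph)\<^sup>*" using less.IH[of m] by auto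
      moreover have "((t - int n, j), (t - int n, m)) \<in> dir graph"
        using 2 by (auto simp: dir_graph_iff intro!: exI[of _ 0])
      ultimately show ?thesis by (rule converse_rtrancl_into_rtrancl[rotated])
    next
      case 3
      then have "((t - int l, m), (t, i)) \<in> (dir graph)\<^sup>*" using IH by auto
      moreover have "((t - int n, j), (t - int l, m)) \<in> dir graph"
        using 3 by (auto simp: dir_graph_iff ar_coeff_def intro!: exI[of _ "n - l"] split: if_splits)
      ultimately show ?thesis by (rule converse_rtrancl_into_rtrancl[rotated])
    qed
  qed
qed

text \<open>For each fixed vector the product tends to zero; dominated convergence applies with the
  bound 1.\<close>

lemma remainder_integral_tendsto_0:
  fixes \<Psi> :: "nat \<Rightarrow> real^'d^'d" and C :: "real^'d^'d"
  assumes "\<And>i j. (\<lambda>k. \<Psi> k $ i $ j) \<longlonglongrightarrow> 0"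
  shows "(\<lambda>k. LINT \<omega>|M. min 1 (norm ((\<Psi> k ** C) *v S 0 \<omega>))) \<longlonglongrightarrow> 0"
proof -
  have lim: "(\<lambda>k. (\<Psi> k ** C) *v x) \<longlonglongrightarrow> 0" for x
  proof (rule vec_tendstoI)
    fix i
    have "(\<lambda>k. \<Sum>j\<in>UNIV. (\<Sum>m\<in>UNIV. \<Psi> k $ i $ m * C $ m $ j) * x $ j) \<longlonglongrightarrow>
        (\<Sum>j\<in>UNIV. (\<Sum>m\<in>UNIV. 0 * C $ m $ j) * x $ j)"
      by (intro tendsto_intros assms)
    then show "(\<lambda>k. ((\<Psi> k ** C) *v x) $ i) \<longlonglongrightarrow> 0 $ i"
      by (simp add: matrix_vector_mult_def matrix_matrix_mult_def)
  qed
  have [measurable]: "(\<lambda>x. (\<Psi> k ** C) *v x) \<in> borel_measurable borel" for k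
    by (intro borel_measurable_continuous_onI matrix_vector_mult_linear_continuous_on)
  have "(\<lambda>k. LINT \<omega>|M. min 1 (norm ((\<Psi> k ** C) *v S 0 \<omega>))) \<longlonglongrightarrow> (LINT \<omega>|M. 0)"
  proof (rule integral_dominated_convergence[where w = "\<lambda>_. 1"])
    show "AE \<omega> in M. (\<lambda>k. min 1 (norm ((\<Psi> k ** C) *v S 0 \<omega>))) \<longlonglongrightarrow> 0"
    proof (rule AE_I2)
      fix \<omega>
      have "(\<lambda>k. min 1 (norm ((\<Psi> k ** C) *v S 0 \<omega>))) \<longlonglongrightarrow> min 1 (norm (0 :: real^'d))"
        by (rule tendsto_min[OF tendsto_const tendsto_norm[OF lim]])
      then show "(\<lambda>k. min 1 (norm ((\<Psi> k ** C) *v S 0 \<omega>))) \<longlonglongrightarrow> 0" by simp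
    qed
  qed auto
  then show ?thesis by simp
qed

text \<open>Stationarity makes the law of the remainder independent of how far back it lies, so the
  remainder vanishes in probability, and almost surely along a subsequence.\<close>

lemma S_AE_limit:
  assumes lim: "\<And>i j. (\<lambda>k. \<Psi> k $ i $ j) \<longlonglongrightarrow> 0"
    and inv: "\<And>n. (\<Sum>l\<le>n. \<Psi> l ** ar_coeff (n - l)) = (if n = 0 then mat 1 else 0)"
  shows "\<exists>r. AE \<omega> in M. (\<lambda>n. \<Sum>k<r n. \<Psi> k *v noise (t - int k) \<omega>) \<longlonglongrightarrow> S t \<omega>"
proof -
  define T where "T n \<omega> = (\<Sum>k<n. \<Psi> k *v noise (t - int k) \<omega>)" for n \<omega>
  define a where "a k j = (LINT \<omega>|M. min 1 (norm ((\<Psi> k ** ar_coeff j) *v S 0 \<omega>)))" for k j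
  have noise_mv: "(\<lambda>\<omega>. noise s \<omega>) \<in> borel_measurable M" for s
  proof (subst borel_measurable_euclidean_space, intro ballI)
    fix b :: "real^'d" assume "b \<in> Basis"
    then obtain i where "b = axis i 1" by (auto simp: Basis_vec_def)
    then show "(\<lambda>\<omega>. noise s \<omega> \<bullet> b) \<in> borel_measurable M"
      using noise_measurable[of "(s, i)" M] by (simp add: cart_eq_inner_axis)
  qed
  note [measurable] = noise_mv
  have [measurable]: "(\<lambda>x. C *v x) \<in> borel_measurable borel" for C :: "real^'d^'d"
    by (intro borel_measurable_continuous_onI matrix_vector_mult_linear_continuous_on)
  have Tm [measurable]: "T n \<in> borel_measurable M" for n unfolding T_def by measurable
  define u where "u n \<omega> = min 1 (norm (T n \<omega> - S t \<omega>))" for n \<omega>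
  have um [measurable]: "u n \<in> borel_measurable M" for n unfolding u_def by measurable
  have uint: "integrable M (u n)" for n
    by (rule integrable_const_bound[where B = 1]) (auto simp: u_def)
  have cint: "integrable M (\<lambda>\<omega>. min 1 (norm (C *v S s \<omega>)))" for C :: "real^'d^'d" and s
    by (rule integrable_const_bound[where B = 1]) auto
  have bound: "(LINT \<omega>|M. norm (u n \<omega>)) \<le> (\<Sum>j\<le>p. \<Sum>k\<in>{n - j..<n}. a k j)" if "n > 0" for n
  proof -
    have eq: "AE \<omega> in M. \<forall>k. (\<Sum>j\<le>p. ar_coeff j *v S (t - int k - int j) \<omega>) = noise (t - int k) \<omega>"
      unfolding AE_all_countable using ar_equation by blast
    have "AE \<omega> in M. u n \<omega> \<le>
        (\<Sum>j\<le>p. \<Sum>k\<in>{n - j..<n}. min 1 (norm ((\<Psi> k ** ar_coeff j) *v S (t - int (k + j)) \<omega>)))"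
      using eq
    proof eventually_elim
      case (elim \<omega>)
      have "T n \<omega> = (\<Sum>k<n. \<Psi> k *v (\<Sum>j\<le>p. ar_coeff j *v S (t - int (k + j)) \<omega>))"
        using elim by (simp add: T_def diff_diff_eq)
      also have "\<dots> = S t \<omega> + (\<Sum>j\<le>p. \<Sum>k\<in>{n - j..<n}. (\<Psi> k ** ar_coeff j) *v S (t - int (k + j)) \<omega>)"
        by (subst truncated_inverse_filter[OF _ inv that, where y = "\<lambda>m. S (t - int m) \<omega>"])
          (auto simp: ar_coeff_def)
      finally have "u n \<omega> = min 1 (norm (\<Sum>j\<le>p. \<Sum>k\<in>{n - j..<n}. (\<Psi> k ** ar_coeff j) *v S (t - int (k + j)) \<omega>))"
        by (simp add: u_def)
      also have "\<dots> \<le> (\<Sum>j\<le>p. min 1 (norm (\<Sum>k\<in>{n - j..<n}. (\<Psi> k ** ar_coeff j) *v S (t - int (k + j)) \<omega>)))"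
        by (rule min_1_norm_sum_le) simp
      also have "\<dots> \<le> (\<Sum>j\<le>p. \<Sum>k\<in>{n - j..<n}. min 1 (norm ((\<Psi> k ** ar_coeff j) *v S (t - int (k + j)) \<omega>)))"
        by (intro sum_mono min_1_norm_sum_le) simp
      finally show ?case .
    qed
    then have "(LINT \<omega>|M. u n \<omega>) \<le>
        (LINT \<omega>|M. (\<Sum>j\<le>p. \<Sum>k\<in>{n - j..<n}. min 1 (norm ((\<Psi> k ** ar_coeff j) *v S (t - int (k + j)) \<omega>))))"
      by (intro integral_mono_AE uint Bochner_Integration.integrable_sum cint)
    also have "\<dots> = (\<Sum>j\<le>p. \<Sum>k\<in>{n - j..<n}. (LINT \<omega>|M. min 1 (norm ((\<Psi> k ** ar_coeff j) *v S (t - int (k + j)) \<omega>))))"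
      by (simp add: cint)
    also have "\<dots> = (\<Sum>j\<le>p. \<Sum>k\<in>{n - j..<n}. a k j)"
      unfolding a_def by (intro sum.cong refl integral_S_shift) measurable
    finally show ?thesis by (simp add: u_def)
  qed
  have "(\<lambda>n. \<Sum>j\<le>p. \<Sum>k\<in>{n - j..<n}. a k j) \<longlonglongrightarrow> 0"
    using remainder_integral_tendsto_0[OF lim]
    by (intro tendsto_null_sum sum_window_tendsto_0) (simp add: a_def)
  then have "(\<lambda>n. LINT \<omega>|M. norm (u n \<omega>)) \<longlonglongrightarrow> 0"
  proof (rule tendsto_0_le[where K = 1])
    show "\<forall>\<^sub>F n in sequentially. norm (LINT \<omega>|M. norm (u n \<omega>)) \<le> norm (\<Sum>j\<le>p. \<Sum>k\<in>{n - j..<n}. a k j) * 1"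
      using eventually_gt_at_top[of 0]
    proof eventually_elim
      case (elim n)
      then show ?case using bound[OF elim] by (auto simp: abs_of_nonneg integral_nonneg_AE)
    qed
  qed
  from tendsto_L1_AE_subseq[OF uint this] obtain r
    where "AE \<omega> in M. (\<lambda>n. u (r n) \<omega>) \<longlonglongrightarrow> 0" by blast
  then have "AE \<omega> in M. (\<lambda>n. T (r n) \<omega>) \<longlonglongrightarrow> S t \<omega>"
  proof eventually_elim
    \<comment> \<open>Once the truncated error is below 1 it equals the error itself.\<close>
    case (elim \<omega>)
    then have "\<forall>\<^sub>F n in sequentially. u (r n) \<omega> < 1" by (rule order_tendstoD) simp
    then have "\<forall>\<^sub>F n in sequentially. u (r n) \<omega> = norm (T (r n) \<omega> - S t \<omega>)"
      by eventually_elim (auto simp: u_def min_def split: if_splits)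
    with elim have "(\<lambda>n. norm (T (r n) \<omega> - S t \<omega>)) \<longlonglongrightarrow> 0" by (rule Lim_transform_eventually)
    then show ?case by (simp add: tendsto_norm_zero_iff LIM_zero_iff)
  qed
  then show ?thesis unfolding T_def by blast
qed

text \<open>By \<open>ma_coeff_nonzero_imp_path\<close> only the noise at ancestors of
  \<open>v\<close> has nonzero weight in the moving average sums, and it involves only innovations
  in \<open>E\<close>. The almost sure limit inherits the measurability.\<close>

lemma endo_AE_eq_ancestral_innov:
  assumes "\<And>u w. (w, v) \<in> (dir graph)\<^sup>* \<Longrightarrow> u \<in> innov_parents w \<Longrightarrow> u \<in> E"
  shows "\<exists>g \<in> borel_measurable (generated_algebra innov E). AE \<omega> in M. endo v \<omega> = g \<omega>"
proof -
  obtain \<Psi> :: "nat \<Rightarrow> real^'d^'d" where \<Psi>: "\<And>i j. (\<lambda>k. \<Psi> k $ i $ j) \<longlonglongrightarrow> 0"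
    "\<And>n. (\<Sum>l\<le>n. \<Psi> l ** ar_coeff (n - l)) = (if n = 0 then mat 1 else 0)"
    using ma_coeff_exists by blast
  obtain t i where v: "v = (t, i)" by (cases v)
  obtain r where r: "AE \<omega> in M. (\<lambda>n. \<Sum>k<r n. \<Psi> k *v noise (t - int k) \<omega>) \<longlonglongrightarrow> S t \<omega>"
    using S_AE_limit[OF \<Psi>] by blast
  define T where "T n \<omega> = (\<Sum>k<r n. \<Sum>j\<in>UNIV. \<Psi> k $ i $ j * noise (t - int k) \<omega> $ j)" for n \<omega>
  have Tlim: "AE \<omega> in M. (\<lambda>n. T n \<omega>) \<longlonglongrightarrow> endo v \<omega>"
    using r
  proof eventually_elim
    case (elim \<omega>)
    from tendsto_vec_nth[OF this, of i]
    show ?case by (simp add: T_def endo_def v sum_component matrix_vector_mult_def)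
  qed
  have "(\<lambda>\<omega>. \<Psi> k $ i $ j * noise (t - int k) \<omega> $ j) \<in> borel_measurable (generated_algebra innov E)" for k j
  proof (cases "\<Psi> k $ i $ j = 0")
    case False
    then have "((t - int k, j), v) \<in> (dir graph)\<^sup>*"
      unfolding v by (rule ma_coeff_nonzero_imp_path[OF \<Psi>(2)])
    then have "(\<lambda>\<omega>. noise (fst (t - int k, j)) \<omega> $ snd (t - int k, j)) \<in> borel_measurable (generated_algebra innov E)"
      by (intro noise_measurable measurable_generated_algebra assms)
    then show ?thesis by simp
  qed simp
  then have "T n \<in> borel_measurable (generated_algebra innov E)" for n
    unfolding T_def[abs_def] by (intro borel_measurable_sum)
  \<comment> \<open>\<open>lim\<close> has a value at every point, so the limit function is
    measurable also across the points of divergence.\<close>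
  then have "(\<lambda>\<omega>. lim (\<lambda>n. T n \<omega>)) \<in> borel_measurable (generated_algebra innov E)"
    by (rule borel_measurable_lim_metric)
  moreover have "AE \<omega> in M. endo v \<omega> = lim (\<lambda>n. T n \<omega>)"
    using Tlim by eventually_elim (rule limI[symmetric])
  ultimately show ?thesis by (intro bexI) auto
qed

end

section \<open>The global Markov property\<close>

context varma
begin

lemma dir_graph_acyclic: "acyclic (dir graph)"
  using admg_varma_admg[OF acyclic_full] by (simp add: admg_def)

text \<open>The whole directed graph may descend forever into the past; between two times there are
  only finitely many vertices.\<close>

lemma wf_dir_graph_window: "wf {(w, v) \<in> dir graph. t0 \<le> fst w \<and> fst v \<le> t1}"
proof (rule finite_acyclic_wf)
  have "{(w, v) \<in> dir graph. t0 \<le> fst w \<and> fst v \<le> t1} \<subseteq> ({t0..t1} \<times> UNIV) \<times> ({t0..t1} \<times> UNIV)"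
    using dir_graph_time by fastforce
  then show "finite {(w, v) \<in> dir graph. t0 \<le> fst w \<and> fst v \<le> t1}"
    by (rule finite_subset) simp
  show "acyclic {(w, v) \<in> dir graph. t0 \<le> fst w \<and> fst v \<le> t1}"
    by (rule acyclic_subset[OF dir_graph_acyclic]) auto
qed

lemma endo_equation:
  "AE \<omega> in M. endo v \<omega> = (\<Sum>k=0..p. \<Sum>j\<in>UNIV. A k $ snd v $ j * endo (fst v - int k, j) \<omega>)
      + noise (fst v) \<omega> $ snd v"
  using S_equation[of "fst v"]
proof eventually_elim
  case (elim \<omega>)
  then have "S (fst v) \<omega> $ snd v = ((\<Sum>k=0..p. A k *v S (fst v - int k) \<omega>) + noise (fst v) \<omega>) $ snd v"
    by (simp add: noise_def add.assoc)
  then show ?case by (simp add: endo_def matrix_vector_mult_def sum_component)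
qed

text \<open>By acyclicity the strict closure leaves out \<open>v\<close> itself: a vertex of
  \<open>Z\<close> has to be expressed through other vertices of \<open>Z\<close> before it can join
  the condition.\<close>

definition strict_ancestors_in :: "(int \<times> 'd) set \<Rightarrow> int \<times> 'd \<Rightarrow> (int \<times> 'd) set" where
  "strict_ancestors_in Z v = {b \<in> Z. (b, v) \<in> (dir graph)\<^sup>+}"

text \<open>Before the first vertex of \<open>Z\<close> the ancestors of \<open>v\<close> stay in \<open>L\<close>, and the moving average
  representation applies; from then on only finitely many structural equations have to be
  solved.\<close>

lemma endo_measurable_join:
  assumes Z: "finite Z"
    and parents: "\<And>v w. v \<in> L \<Longrightarrow> (w, v) \<in> dir graph \<Longrightarrow> w \<notin> Z \<Longrightarrow> w \<in> L"
    and innovs: "\<And>u v. v \<in> L \<Longrightarrow> u \<in> innov_parents v \<Longrightarrow> u \<in> E"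
    and v: "v \<in> L"
  shows "endo v \<in> borel_measurable
    (join_algebra (null_completion (generated_algebra innov E)) (generated_algebra endo (strict_ancestors_in Z v)))"
proof -
  let ?F = "null_completion (generated_algebra innov E)"
  \<comment> \<open>The algebra varies with the vertex, so that only values of \<open>Z\<close>
    strictly above \<open>w\<close> are used for \<open>w\<close>; \<open>Hmono\<close> passes
    measurability down an edge.\<close>
  define H where "H w = join_algebra ?F (generated_algebra endo (strict_ancestors_in Z w))" for w
  have subI: "subalgebra M (generated_algebra innov E)" by (intro subalgebra_generated_algebra) measurable
  have subF: "subalgebra M ?F" by (rule subalgebra_null_completion[OF subI])
  have subG: "subalgebra M (generated_algebra endo N)" for N by (intro subalgebra_generated_algebra) measurable
  have subH: "subalgebra M (H w)" for w
    unfolding H_def by (rule subalgebra_join_algebra[OF subF subG])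
  have spH: "space (H w) = space M" for w using subH by (simp add: subalgebra_def)
  have upF: "sets ?F \<subseteq> sets (H w)" and upG: "sets (generated_algebra endo (strict_ancestors_in Z w)) \<subseteq> sets (H w)" for w
    unfolding H_def by (simp_all add: join_algebra_upper)
  have fromF: "f \<in> borel_measurable (H w)" if "f \<in> borel_measurable (generated_algebra innov E)"
    for f :: "_ \<Rightarrow> real" and w
    by (rule measurable_from_subalg[OF _ that])
      (use order.trans[OF sets_subset_null_completion[OF subI] upF] in \<open>simp add: subalgebra_def spH\<close>)
  have fromG: "endo b \<in> borel_measurable (H w)" if "b \<in> Z" "(b, w) \<in> (dir graph)\<^sup>+" for b w
    by (rule measurable_from_subalg[OF _ measurable_generated_algebra[of b "strict_ancestors_in Z w"]])
      (use upG[of w] that in \<open>simp_all add: subalgebra_def spH strict_ancestors_in_def\<close>)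
  have Hmono: "f \<in> borel_measurable (H w)" if "f \<in> borel_measurable (H x)" "(x, w) \<in> dir graph"
    for f :: "_ \<Rightarrow> real" and x w
  proof (rule measurable_from_subalg[OF _ that(1)])
    have "strict_ancestors_in Z x \<subseteq> strict_ancestors_in Z w"
      using that(2) by (auto simp: strict_ancestors_in_def intro: trancl_into_trancl)
    then have "sets (generated_algebra endo (strict_ancestors_in Z x)) \<subseteq> sets (H w)"
      using generated_algebra_mono upG by blast
    then have "sets (H x) \<subseteq> sets (H w)"
      unfolding H_def[of x] using upF spH by (intro join_algebra_least) auto
    then show "subalgebra (H w) (H x)" by (simp add: subalgebra_def spH)
  qed
  have AE_meas: "endo w \<in> borel_measurable (H w)"
    if "g \<in> borel_measurable (H w)" "AE \<omega> in M. endo w \<omega> = g \<omega>" for g w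
  proof (rule measurable_AE_cong[OF subH _ endo_measurable that])
    show "N \<in> sets (H w)" if "N \<in> events" "AE x in M. x \<notin> N" for N
      using null_sets_null_completion[OF subI that] upF by blast
  qed
  \<comment> \<open>Without an ancestor in \<open>Z\<close>, going backwards never leaves
    \<open>L\<close>, so all innovations in the moving average representation of \<open>w\<close>
    belong to \<open>E\<close>.\<close>
  have base: "endo w \<in> borel_measurable (H w)" if "w \<in> L" "\<And>b. b \<in> Z \<Longrightarrow> (b, w) \<notin> (dir graph)\<^sup>*" for w
  proof -
    have "x \<in> L" if "(x, w) \<in> (dir graph)\<^sup>*" for x
      using that
    proof (induction rule: converse_rtrancl_induct)
      case (step y z)
      have "y \<notin> Z" using step.hyps \<open>\<And>b. b \<in> Z \<Longrightarrow> (b, w) \<notin> (dir graph)\<^sup>*\<close>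
        by (meson converse_rtrancl_into_rtrancl)
      then show ?case using parents step by blast
    qed (rule \<open>w \<in> L\<close>)
    then have "\<exists>g \<in> borel_measurable (generated_algebra innov E). AE \<omega> in M. endo w \<omega> = g \<omega>"
      by (intro endo_AE_eq_ancestral_innov) (rule innovs)
    then obtain g where "g \<in> borel_measurable (generated_algebra innov E)" "AE \<omega> in M. endo w \<omega> = g \<omega>"
      by blast
    then show ?thesis by (intro AE_meas[of g] fromF)
  qed
  \<comment> \<open>If \<open>Z\<close> is empty, \<open>Min\<close> is unspecified and any integer
    serves, as the bound below concerns only elements of \<open>Z\<close>.\<close>
  define t0 where "t0 = Min (fst ` Z)"
  have t0: "t0 \<le> fst w" if "b \<in> Z" "(b, w) \<in> (dir graph)\<^sup>*" for b w
  proof -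
    have "t0 \<le> fst b" unfolding t0_def by (rule Min_le) (use Z that(1) in auto)
    then show ?thesis using dir_graph_rtrancl_time[OF that(2)] by simp
  qed
  have "fst w \<le> fst v \<Longrightarrow> w \<in> L \<Longrightarrow> endo w \<in> borel_measurable (H w)" for w
    using wf_dir_graph_window[of t0 "fst v"]
  proof (induction w)
    case (less w)
    show ?case
    proof (rule AE_meas[OF _ endo_equation])
      have par: "endo x \<in> borel_measurable (H w)" if x: "(x, w) \<in> dir graph" for x
      proof (cases "x \<in> Z")
        case True
        then show ?thesis using fromG x by blast
      next
        case False
        then have xL: "x \<in> L" using parents less.prems(2) x by blast
        \<comment> \<open>A parent at or after \<open>t0\<close> is covered by the induction; one
          before \<open>t0\<close> has no ancestor in \<open>Z\<close>, itself included.\<close>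
        have "endo x \<in> borel_measurable (H x)"
        proof (cases "t0 \<le> fst x")
          case True
          have "fst x \<le> fst v" using dir_graph_time[OF x] less.prems(1) by simp
          then show ?thesis using less.IH[of x] x True less.prems(1) xL by simp
        next
          case False
          then show ?thesis using base[OF xL] t0 by blast
        qed
        then show ?thesis using Hmono x by blast
      qed
      have "(\<lambda>\<omega>. A k $ snd w $ j * endo (fst w - int k, j) \<omega>) \<in> borel_measurable (H w)"
        if "k \<in> {0..p}" for k j
      proof (cases "A k $ snd w $ j = 0")
        case False
        then have "((fst w - int k, j), w) \<in> dir graph"
          using that by (auto simp: dir_graph_iff intro!: exI[of _ k])
        from par[OF this] show ?thesis by measurable
      qed simp
      moreover have "(\<lambda>\<omega>. noise (fst w) \<omega> $ snd w) \<in> borel_measurable (H w)"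
        by (intro noise_measurable fromF measurable_generated_algebra) (rule innovs[OF less.prems(2)])
      ultimately show "(\<lambda>\<omega>. (\<Sum>k=0..p. \<Sum>j\<in>UNIV. A k $ snd w $ j * endo (fst w - int k, j) \<omega>)
          + noise (fst w) \<omega> $ snd w) \<in> borel_measurable (H w)"
        by (intro borel_measurable_add borel_measurable_sum)
    qed
  qed
  then show ?thesis using v by (simp add: H_def)
qed

section \<open>From solved equations to conditional independence\<close>

lemma values_at_eq: "values_at S N = (\<lambda>\<omega>. \<lambda>v\<in>N. endo v \<omega>)"
  by (auto simp: values_at_def endo_def fun_eq_iff restrict_def)

lemma generated_algebra_endo:
  "generated_algebra endo N = vimage_algebra (space M) (values_at S N) (\<Pi>\<^sub>M v\<in>N. borel)"
  by (simp add: generated_algebra_def values_at_eq)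

lemma cond_indep_endo:
  assumes NB: "finite NB" and disj: "NA \<inter> NB = {}" "NB \<inter> NC = {}"
    and sep: "m_separated graph NA NC NB"
  obtains F1 F2 where "subalgebra M F1" "subalgebra M F2"
    "cond_indep_algebra F1 F2 (generated_algebra endo NB)"
    "\<And>v. v \<in> NA \<Longrightarrow> endo v \<in> borel_measurable (join_algebra F1 (generated_algebra endo NB))"
    "\<And>v. v \<in> NC \<Longrightarrow> endo v \<in> borel_measurable (join_algebra F2 (generated_algebra endo NB))"
proof -
  define W where "W = ancestors graph (NA \<union> NC \<union> NB)"
  from m_separated_partition[OF sep disj(1)] obtain K where
    K: "K \<subseteq> W" "NA \<subseteq> K" "NC \<inter> K = {}"
    and K_parents: "\<And>v w. v \<in> K \<Longrightarrow> (w, v) \<in> dir graph \<Longrightarrow> w \<notin> NB \<Longrightarrow> w \<in> K"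
    and K_children: "\<And>v w. w \<in> K \<Longrightarrow> w \<notin> NB \<Longrightarrow> (w, v) \<in> dir graph \<Longrightarrow> v \<in> W \<Longrightarrow> v \<in> K"
    and K_bidir: "\<And>v w. v \<in> K \<Longrightarrow> (v, w) \<in> bidir graph \<Longrightarrow> w \<in> W \<Longrightarrow> w \<in> K"
    unfolding W_def by blast
  have W_sup: "NA \<union> NC \<union> NB \<subseteq> W" by (auto simp: W_def ancestors_def descendants_def)
  have W_parents: "w \<in> W" if "(w, v) \<in> dir graph" "v \<in> W" for v w
    using that descendants_edge unfolding W_def ancestors_def by fastforce
  \<comment> \<open>\<open>L\<close> is closed under parents outside \<open>NB\<close>: such a
    parent in \<open>K\<close> would pull its child in \<open>W\<close> into
    \<open>K\<close>.\<close>
  define L where "L = W - K"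
  have L_parents: "w \<in> L" if "v \<in> L" "(w, v) \<in> dir graph" "w \<notin> NB" for v w
    using that K_children[of w v] W_parents[of w v] unfolding L_def by blast
  define E1 where "E1 = (\<Union>v\<in>K. innov_parents v)"
  define E2 where "E2 = (\<Union>v\<in>L. innov_parents v)"
  have E: "E1 \<inter> E2 = {}"
  proof (rule ccontr)
    assume "E1 \<inter> E2 \<noteq> {}"
    then obtain u v w where uvw: "v \<in> K" "w \<in> L" "u \<in> innov_parents v" "u \<in> innov_parents w"
      by (auto simp: E1_def E2_def)
    \<comment> \<open>A shared innovation is a bi-directed edge; the vertices are distinct because
      \<open>K\<close> and \<open>L\<close> are disjoint.\<close>
    then have "(v, w) \<in> bidir graph" by (cases u) (auto simp: varma_admg_def L_def)
    then show False using K_bidir[OF uvw(1), of w] uvw(2) by (simp add: L_def)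
  qed
  define F1 where "F1 = null_completion (generated_algebra innov E1)"
  define F2 where "F2 = null_completion (generated_algebra innov E2)"
  define G where "G N = generated_algebra endo N" for N
  have subI: "subalgebra M (generated_algebra innov N)" for N by (intro subalgebra_generated_algebra) measurable
  have subF: "subalgebra M F1" "subalgebra M F2"
    unfolding F1_def F2_def by (intro subalgebra_null_completion subI)+
  have subG: "subalgebra M (G N)" for N unfolding G_def by (intro subalgebra_generated_algebra) measurable
  have upper: "sets (join_algebra F (G N)) \<subseteq> sets (join_algebra F (G N'))"
    if "N \<subseteq> N'" "subalgebra M F" for N N' F
  proof (rule join_algebra_least)
    have "sets (G N) \<subseteq> sets (G N')" unfolding G_def by (rule generated_algebra_mono[OF that(1)])
    then show "sets (G N) \<subseteq> sets (join_algebra F (G N'))"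
      using join_algebra_upper(2)[of F "G N'"] that(2) subG by (auto simp: subalgebra_def)
  qed (use that(2) subG join_algebra_upper(1)[of F "G N'"] in \<open>auto simp: subalgebra_def\<close>)
  have meas: "endo v \<in> borel_measurable (join_algebra F (G N))"
    if "endo v \<in> borel_measurable (join_algebra F (G (strict_ancestors_in NB v)))"
      "strict_ancestors_in NB v \<subseteq> N" "subalgebra M F" for v F N
    by (rule measurable_from_subalg[OF _ that(1)]) (use upper[OF that(2,3)] in \<open>simp add: subalgebra_def\<close>)
  have measK: "endo v \<in> borel_measurable (join_algebra F1 (G N))"
    if "v \<in> K" "strict_ancestors_in NB v \<subseteq> N" for v N
  proof (rule meas[OF _ that(2) subF(1)], unfold F1_def G_def, rule endo_measurable_join[OF NB])
    show "w \<in> K" if "x \<in> K" "(w, x) \<in> dir graph" "w \<notin> NB" for x w using K_parents that by blast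
    show "u \<in> E1" if "x \<in> K" "u \<in> innov_parents x" for u x using that by (auto simp: E1_def)
  qed (rule that(1))
  have measL: "endo v \<in> borel_measurable (join_algebra F2 (G N))"
    if "v \<in> L" "strict_ancestors_in NB v \<subseteq> N" for v N
  proof (rule meas[OF _ that(2) subF(2)], unfold F2_def G_def, rule endo_measurable_join[OF NB])
    show "w \<in> L" if "x \<in> L" "(w, x) \<in> dir graph" "w \<notin> NB" for x w using L_parents that by blast
    show "u \<in> E2" if "x \<in> L" "u \<in> innov_parents x" for u x using that by (auto simp: E2_def)
  qed (rule that(1))
  \<comment> \<open>The value at \<open>b\<close> is a function of one side and the remaining
    condition, so the enlarged condition stays in their join. The enlarged side is then cut back to
    \<open>Fa\<close>, which keeps the same pair of algebras throughout the induction.\<close>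
  have step: "cond_indep_algebra Fa Fb (G N)"
    if sub: "subalgebra M Fa" "subalgebra M Fb"
      and ci: "cond_indep_algebra Fa Fb (G (N - {b}))"
      and b: "endo b \<in> borel_measurable (join_algebra Fa (G (N - {b})))"
    for Fa Fb N b
  proof -
    have sp: "space Fa = space M" "space (G (N - {b})) = space M"
      using sub subG by (auto simp: subalgebra_def)
    have "sets (G N) \<subseteq> sets (join_algebra Fa (G (N - {b})))"
      unfolding G_def[of N]
    proof (rule generated_algebra_least)
      fix v assume v: "v \<in> N"
      show "endo v \<in> borel_measurable (join_algebra Fa (G (N - {b})))"
      proof (cases "v = b")
        case False
        then have "endo v \<in> borel_measurable (G (N - {b}))"
          unfolding G_def using v by (intro measurable_generated_algebra) auto
        then show ?thesis
          by (rule measurable_from_subalg[rotated])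
            (use join_algebra_upper(2)[of Fa "G (N - {b})"] sp in \<open>simp add: subalgebra_def\<close>)
      qed (use b in simp)
    qed (simp add: sp)
    moreover have "sets (G (N - {b})) \<subseteq> sets (G N)"
      unfolding G_def by (rule generated_algebra_mono) auto
    ultimately have "cond_indep_algebra (join_algebra Fa (G (N - {b}))) Fb (G N)"
      using cond_indep_algebra_extend[OF sub subG subG ci] by blast
    then show ?thesis
      by (rule cond_indep_algebra_mono) (use join_algebra_upper(1)[of Fa "G (N - {b})"] sp in auto)
  qed
  \<comment> \<open>The vertices of \<open>NB\<close> are added to the condition in an ancestral order, so that each one is a
    function of one of the two sides and of those added before.\<close>
  have ind: "cond_indep_algebra F1 F2 (G N)"
    if "N \<subseteq> NB" "\<And>v. v \<in> N \<Longrightarrow> strict_ancestors_in NB v \<subseteq> N" for N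
    using that
  proof (induction "card N" arbitrary: N rule: less_induct)
    case less
    have finN: "finite N" using less.prems(1) NB finite_subset by blast
    show ?case
    proof (cases "N = {}")
      case True
      have "prob (U \<inter> V) = prob U * prob V" if "U \<in> sets F1" "V \<in> sets F2" for U V
        using that prob_Int_null_completion[OF subI subI prob_Int_generated_algebra[OF indep_vars_innov E]]
        unfolding F1_def F2_def by blast
      then show ?thesis
        using cond_indep_algebra_trivial[OF subF subG[of N]] sets_generated_algebra_empty[of endo]
        unfolding True G_def by blast
    next
      case False
      \<comment> \<open>A vertex \<open>b\<close> that is a strict ancestor of no vertex of
        \<open>N\<close> is split off, so the rest still contains all strict ancestors in
        \<open>NB\<close> of its members.\<close>
      define R where "R = (dir graph)\<^sup>+ \<inter> N \<times> N"
      have "acyclic R"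
      proof (rule acyclic_subset)
        show "acyclic ((dir graph)\<^sup>+)" using dir_graph_acyclic by (simp add: acyclic_def)
      qed (simp add: R_def)
      moreover have "finite R" using finN by (simp add: R_def)
      ultimately have "wf (R\<inverse>)" by (rule finite_acyclic_wf_converse[rotated])
      then obtain b where b: "b \<in> N" and bmax: "\<And>v. (v, b) \<in> R\<inverse> \<Longrightarrow> v \<notin> N"
        using False by (rule wfE_min') (rule that)
      have max: "(b, v) \<notin> (dir graph)\<^sup>+" if "v \<in> N" for v
        using bmax[of v] that b by (auto simp: R_def)
      have N': "strict_ancestors_in NB v \<subseteq> N - {b}" if "v \<in> N" for v
        using less.prems(2)[OF that] max[OF that] unfolding strict_ancestors_in_def by blast
      have IH: "cond_indep_algebra F1 F2 (G (N - {b}))"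
      proof (rule less.hyps)
        show "card (N - {b}) < card N" using finN b by (rule card_Diff1_less)
        show "N - {b} \<subseteq> NB" using less.prems(1) by blast
        show "strict_ancestors_in NB v \<subseteq> N - {b}" if "v \<in> N - {b}" for v using N' that by blast
      qed
      have "b \<in> W" using b less.prems(1) W_sup by blast
      then consider "b \<in> K" | "b \<in> L" by (auto simp: L_def)
      then show ?thesis
      proof cases
        case 1
        show ?thesis by (rule step[OF subF IH measK[OF 1 N'[OF b]]])
      next
        case 2
        show ?thesis
          by (rule cond_indep_algebra_sym)
            (rule step[OF subF(2,1) cond_indep_algebra_sym[OF IH] measL[OF 2 N'[OF b]]])
      qed
    qed
  qed
  show ?thesis
  proof
    show "subalgebra M F1" "subalgebra M F2" by (rule subF)+
    show "cond_indep_algebra F1 F2 (generated_algebra endo NB)"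
      using ind[of NB] by (simp add: G_def strict_ancestors_in_def)
    show "endo v \<in> borel_measurable (join_algebra F1 (generated_algebra endo NB))" if "v \<in> NA" for v
      using measK[of v NB] K(2) that by (auto simp: G_def strict_ancestors_in_def)
    show "endo v \<in> borel_measurable (join_algebra F2 (generated_algebra endo NB))" if "v \<in> NC" for v
      using measL[of v NB] K(3) W_sup that by (auto simp: G_def strict_ancestors_in_def L_def)
  qed
qed

end

theorem theorem3:
  fixes M :: "'w measure"
    and p q :: nat
    and A B :: "nat \<Rightarrow> real^'d^'d"
    and \<epsilon> S :: "int \<Rightarrow> 'w \<Rightarrow> real^'d"
    and NA NB NC :: "(int \<times> 'd) set"
  assumes "varma M p q A B \<epsilon> S"
    and "finite NA" and "finite NB" and "finite NC"
    and "NA \<inter> NB = {}" and "NA \<inter> NC = {}" and "NB \<inter> NC = {}"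
    and "m_separated (varma_admg p q A B) NA NC NB"
  shows "prob_space.cond_indep_var M
           (\<Pi>\<^sub>M v\<in>NA. borel) (values_at S NA)
           (\<Pi>\<^sub>M v\<in>NC. borel) (values_at S NC)
           (\<Pi>\<^sub>M v\<in>NB. borel) (values_at S NB)"
proof -
  interpret varma M p q A B \<epsilon> S by (rule assms(1))
  let ?G = "generated_algebra endo NB"
  obtain F1 F2 where F: "subalgebra M F1" "subalgebra M F2" "cond_indep_algebra F1 F2 ?G"
    and FA: "\<And>v. v \<in> NA \<Longrightarrow> endo v \<in> borel_measurable (join_algebra F1 ?G)"
    and FC: "\<And>v. v \<in> NC \<Longrightarrow> endo v \<in> borel_measurable (join_algebra F2 ?G)"
    using cond_indep_endo[OF assms(3,5,7,8)] by blast
  have subG: "subalgebra M ?G" by (intro subalgebra_generated_algebra) measurable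
  have upper: "sets ?G \<subseteq> sets (join_algebra F1 ?G)" "sets ?G \<subseteq> sets (join_algebra F2 ?G)"
    by (rule join_algebra_upper(2), use F(1,2) in \<open>simp add: subalgebra_def\<close>)+
  \<comment> \<open>Taking the old condition as the new one adjoins it to each side in turn; the
    values at \<open>NA\<close> and \<open>NC\<close> are measurable for these enlarged
    sides.\<close>
  have ci1: "cond_indep_algebra (join_algebra F1 ?G) F2 ?G"
    by (rule cond_indep_algebra_extend[OF F(1,2) subG subG F(3) _ upper(1)]) simp
  have "cond_indep_algebra (join_algebra F2 ?G) (join_algebra F1 ?G) ?G"
    by (rule cond_indep_algebra_extend[OF F(2) subalgebra_join_algebra[OF F(1) subG] subG subG
          cond_indep_algebra_sym[OF ci1] order.refl upper(2)])
  then have ci: "cond_indep_algebra (join_algebra F1 ?G) (join_algebra F2 ?G) ?G"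
    by (rule cond_indep_algebra_sym)
  have sp: "space F1 = space M" "space F2 = space M" using F(1,2) by (auto simp: subalgebra_def)
  have meas: "values_at S N \<in> measurable H (\<Pi>\<^sub>M v\<in>N. borel)"
    if "\<And>v. v \<in> N \<Longrightarrow> endo v \<in> borel_measurable H" for N H
    unfolding values_at_eq by (rule measurable_restrict) (rule that)
  have measM: "values_at S N \<in> measurable M (\<Pi>\<^sub>M v\<in>N. borel)" for N
    by (rule meas) measurable
  show ?thesis unfolding cond_indep_var_def generated_algebra_endo[symmetric]
  proof (intro conjI ballI measM)
    fix U V assume UV: "U \<in> sets (\<Pi>\<^sub>M v\<in>NA. borel :: real measure)" "V \<in> sets (\<Pi>\<^sub>M v\<in>NC. borel :: real measure)"
    have X: "values_at S NA -` U \<inter> space M \<in> sets (join_algebra F1 ?G)"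
      using measurable_sets[OF meas[OF FA] UV(1)] by (simp add: sp)
    have Y: "values_at S NC -` V \<inter> space M \<in> sets (join_algebra F2 ?G)"
      using measurable_sets[OF meas[OF FC] UV(2)] by (simp add: sp)
    have XY: "values_at S NA -` U \<inter> values_at S NC -` V \<inter> space M =
        (values_at S NA -` U \<inter> space M) \<inter> (values_at S NC -` V \<inter> space M)" by auto
    show "AE \<omega> in M.
        real_cond_exp M ?G (indicator (values_at S NA -` U \<inter> values_at S NC -` V \<inter> space M)) \<omega> =
        real_cond_exp M ?G (indicator (values_at S NA -` U \<inter> space M)) \<omega> *
        real_cond_exp M ?G (indicator (values_at S NC -` V \<inter> space M)) \<omega>"
      unfolding XY by (rule ci[unfolded cond_indep_algebra_def, rule_format, OF X Y])
  qed
qed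

end
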